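(* Let $M$ be a smooth manifold equipped with a general $(\alpha,\beta)$-metric $F(x,y)=\alpha\,\phi\!\left(b^2,\frac{\beta}{\alpha}\right)$, where $\alpha(x,y)=\sqrt{g(y,y)}$ for a Riemannian metric $g$ on $M$, $\beta$ is a 1-form on $M$ and $b^2=\|\beta\|_\alpha^2$. If $\beta$ is parallel with respect to $\alpha$ (i.e. $\nabla\beta=0$ for the Levi-Civita connection $\nabla$ of $g$), then for every flag $P=\mathrm{span}\{y,u\}\subset T_xM$ with flagpole $y$ ($y,u$ linearly independent) the flag curvature $K^F(y,P)$ of $F$ is given by $$K^F(y,P)=\frac{\alpha^2\|u\|_\alpha^2-g(y,u)^2}{F^2\,g^F_y(u,u)-g^F_y(y,u)^2}\;\rho\;K^g(P),$$ where $\rho=\phi(\phi-s\phi_2)$, and $K^g(P)$ is the sectional curvature of $g$ on $P$. Here $\alpha,F$ are evaluated at $(x,y)$, and $\phi,\phi_2$ at $(b^2,s)$ with $s=\frac{\beta(y)}{\alpha(y)}$. In the particular case that $\{y,u\}$ is an orthonormal set with respect to $g$, $$K^F(y,P)=\frac{1}{\phi^2\left(1+g(X,u)^2 D\right)}\,K^g(P),\qquad D:=\frac{\phi_{22}}{\phi-s\phi_2},$$ where $X$ is the vector field corresponding to the 1-form $\beta$ with respect to $g$ (i.e. $\beta(\cdot)=g(X,\cdot)$).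
   Context: General $(\alpha,\beta)$-metric of this form: $F=\alpha\phi(b^2,\beta/\alpha)$ where $\alpha(x,y)=\sqrt{g_x(y,y)}$, $b=\|\beta\|_\alpha$ is the pointwise norm of $\beta$ with respect to $g$, $b<b_0$ for some $0<b_0\le+\infty$, and $\phi=\phi(b^2,s)$ is a positive $C^\infty$ function on $|s|\le b<b_0$ such that $F$ is a Finsler metric, equivalently $\phi-s\phi_2+(b^2-s^2)\phi_{22}>0$ and, if $\dim M\ge 3$, also $\phi-s\phi_2>0$. Subscript $2$ denotes the partial derivative with respect to the second variable $s$ (so $\phi_{22}$ is the second derivative in $s$). $\|u\|_\alpha^2=g(u,u)$. $g^F_y(u,v)=\frac12\frac{\partial^2}{\partial s\,\partial t}F^2(x,y+su+tv)\big|_{s=t=0}$ is the fundamental tensor of $F$. The spray coefficients of $F$ are $G^i=\frac14 (g^F)^{il}\left([F^2]_{x^ky^l}y^k-[F^2]_{x^l}\right)$, the Riemann curvature is $R^i_k=2\frac{\partial G^i}{\partial x^k}-y^j\frac{\partial^2G^i}{\partial x^j\partial y^k}+2G^j\frac{\partial^2G^i}{\partial y^j\partial y^k}-\frac{\partial G^i}{\partial y^j}\frac{\partial G^j}{\partial y^k}$, $R_y(u)=R^i_ku^k\frac{\partial}{\partial x^i}$, and the flag curvature is $K^F(y,P)=\dfrac{g^F_y(R_y(u),u)}{g^F_y(y,y)g^F_y(u,u)-g^F_y(y,u)^2}$. *)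

theory Defs
  imports "HOL-Analysis.Analysis"
begin

section \<open>Smooth maps and partial derivatives\<close>

primrec Ck_on :: "nat \<Rightarrow> ('a::real_normed_vector \<Rightarrow> 'b::real_normed_vector) \<Rightarrow> 'a set \<Rightarrow> bool" where
  "Ck_on 0 f S \<longleftrightarrow> continuous_on S f"
| "Ck_on (Suc k) f S \<longleftrightarrow> (\<forall>x\<in>S. f differentiable (at x)) \<and>
     (\<forall>v. Ck_on k (\<lambda>x. frechet_derivative f (at x) v) S)"

text \<open>Only meant for open \<open>S\<close> (all derivatives are taken in the ambient space).\<close>

definition smooth_on :: "('a::real_normed_vector \<Rightarrow> 'b::real_normed_vector) \<Rightarrow> 'a set \<Rightarrow> bool" where
  "smooth_on f S \<longleftrightarrow> (\<forall>k. Ck_on k f S)"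

definition pd :: "'n \<Rightarrow> (real^'n \<Rightarrow> real) \<Rightarrow> real^'n \<Rightarrow> real" where
  "pd i f p = deriv (\<lambda>t. f (p + t *\<^sub>R axis i 1)) 0"

section \<open>Manifolds and tangent vectors\<close>

text \<open>A chart is a pair of its domain and its coordinate map; the values of the coordinate map
  outside the domain are irrelevant. The dimension of the manifold is \<open>CARD('n)\<close>.\<close>

type_synonym ('m, 'n) chart = "'m set \<times> ('m \<Rightarrow> real^'n)"

abbreviation chart_dom :: "('m, 'n) chart \<Rightarrow> 'm set" where
  "chart_dom c \<equiv> fst c"

abbreviation coord :: "('m, 'n) chart \<Rightarrow> 'm \<Rightarrow> real^'n" where
  "coord c \<equiv> snd c"

definition chart_inv :: "('m, 'n) chart \<Rightarrow> real^'n \<Rightarrow> 'm" where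
  "chart_inv c = inv_into (chart_dom c) (coord c)"

definition chart_image :: "('m, 'n) chart \<Rightarrow> (real^'n) set" where
  "chart_image c = coord c ` chart_dom c"

definition transition :: "('m, 'n) chart \<Rightarrow> ('m, 'n) chart \<Rightarrow> real^'n \<Rightarrow> real^'n" where
  "transition c c' = coord c' \<circ> chart_inv c"

definition smooth_manifold :: "'m topology \<Rightarrow> ('m, 'n::finite) chart set \<Rightarrow> bool" where
  "smooth_manifold M A \<longleftrightarrow>
     Hausdorff_space M \<and> second_countable M \<and>
     (\<Union>c\<in>A. chart_dom c) = topspace M \<and>
     (\<forall>c\<in>A. openin M (chart_dom c) \<and> open (chart_image c) \<and>
        homeomorphic_map (subtopology M (chart_dom c)) (top_of_set (chart_image c)) (coord c)) \<and>
     (\<forall>c\<in>A. \<forall>c'\<in>A. smooth_on (transition c c') (coord c ` (chart_dom c \<inter> chart_dom c')))"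

text \<open>A tangent vector at \<open>x\<close> is the family of its component vectors in all charts around \<open>x\<close>,
  which transform by the Jacobians of the coordinate changes. At indices that are not charts of
  the atlas around \<open>x\<close> the family is set to \<open>0\<close>, so that equality of tangent vectors is equality
  of functions.\<close>

type_synonym ('m, 'n) tvec = "('m, 'n) chart \<Rightarrow> real^'n"

definition tangent_space :: "('m, 'n::finite) chart set \<Rightarrow> 'm \<Rightarrow> ('m, 'n) tvec set" where
  "tangent_space A x = {v.
     (\<forall>c\<in>A. \<forall>c'\<in>A. x \<in> chart_dom c \<inter> chart_dom c' \<longrightarrow>
        v c' = frechet_derivative (transition c c') (at (coord c x)) (v c)) \<and>
     (\<forall>c. \<not> (c \<in> A \<and> x \<in> chart_dom c) \<longrightarrow> v c = 0)}"

definition tzero :: "('m, 'n::finite) tvec" where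
  "tzero = (\<lambda>c. 0)"

definition tadd :: "('m, 'n::finite) tvec \<Rightarrow> ('m, 'n) tvec \<Rightarrow> ('m, 'n) tvec" where
  "tadd u v = (\<lambda>c. u c + v c)"

definition tscale :: "real \<Rightarrow> ('m, 'n::finite) tvec \<Rightarrow> ('m, 'n) tvec" where
  "tscale a v = (\<lambda>c. a *\<^sub>R v c)"

definition lin_indep2 :: "('m, 'n::finite) tvec \<Rightarrow> ('m, 'n) tvec \<Rightarrow> bool" where
  "lin_indep2 y u \<longleftrightarrow> (\<forall>a b. tadd (tscale a y) (tscale b u) = tzero \<longrightarrow> a = 0 \<and> b = 0)"

text \<open>The tangent vector at \<open>x\<close> with components \<open>w\<close> in the chart \<open>c\<close>.\<close>

definition tvec_of :: "('m, 'n::finite) chart set \<Rightarrow> 'm \<Rightarrow> ('m, 'n) chart \<Rightarrow> real^'n \<Rightarrow> ('m, 'n) tvec" where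
  "tvec_of A x c w = (\<lambda>c'. if c' \<in> A \<and> x \<in> chart_dom c'
     then frechet_derivative (transition c c') (at (coord c x)) w else 0)"

definition coord_vec :: "('m, 'n::finite) chart set \<Rightarrow> ('m, 'n) chart \<Rightarrow> real^'n \<Rightarrow> 'n \<Rightarrow> ('m, 'n) tvec" where
  "coord_vec A c p i = tvec_of A (chart_inv c p) c (axis i 1)"

section \<open>Riemannian metrics and 1-forms\<close>

definition metric_mat ::
    "('m, 'n::finite) chart set \<Rightarrow> ('m \<Rightarrow> ('m, 'n) tvec \<Rightarrow> ('m, 'n) tvec \<Rightarrow> real) \<Rightarrow>
     ('m, 'n) chart \<Rightarrow> real^'n \<Rightarrow> real^'n^'n" where
  "metric_mat A g c p = (\<chi> i j. g (chart_inv c p) (coord_vec A c p i) (coord_vec A c p j))"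

definition form_comp ::
    "('m, 'n::finite) chart set \<Rightarrow> ('m \<Rightarrow> ('m, 'n) tvec \<Rightarrow> real) \<Rightarrow>
     ('m, 'n) chart \<Rightarrow> 'n \<Rightarrow> real^'n \<Rightarrow> real" where
  "form_comp A \<beta> c i p = \<beta> (chart_inv c p) (coord_vec A c p i)"

definition tangent_linear :: "('m, 'n::finite) tvec set \<Rightarrow> (('m, 'n) tvec \<Rightarrow> real) \<Rightarrow> bool" where
  "tangent_linear T f \<longleftrightarrow>
     (\<forall>u\<in>T. \<forall>v\<in>T. f (tadd u v) = f u + f v) \<and> (\<forall>u\<in>T. \<forall>a. f (tscale a u) = a * f u)"

definition riemannian_metric ::
    "'m topology \<Rightarrow> ('m, 'n::finite) chart set \<Rightarrow>
     ('m \<Rightarrow> ('m, 'n) tvec \<Rightarrow> ('m, 'n) tvec \<Rightarrow> real) \<Rightarrow> bool" where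
  "riemannian_metric M A g \<longleftrightarrow>
     (\<forall>x\<in>topspace M. \<forall>u\<in>tangent_space A x.
        tangent_linear (tangent_space A x) (g x u) \<and>
        (\<forall>v\<in>tangent_space A x. g x u v = g x v u) \<and>
        (u \<noteq> tzero \<longrightarrow> g x u u > 0)) \<and>
     (\<forall>c\<in>A. smooth_on (metric_mat A g c) (chart_image c))"

definition one_form ::
    "'m topology \<Rightarrow> ('m, 'n::finite) chart set \<Rightarrow> ('m \<Rightarrow> ('m, 'n) tvec \<Rightarrow> real) \<Rightarrow> bool" where
  "one_form M A \<beta> \<longleftrightarrow>
     (\<forall>x\<in>topspace M. tangent_linear (tangent_space A x) (\<beta> x)) \<and>
     (\<forall>c\<in>A. \<forall>i. smooth_on (form_comp A \<beta> c i) (chart_image c))"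

definition sharp ::
    "('m, 'n::finite) chart set \<Rightarrow> ('m \<Rightarrow> ('m, 'n) tvec \<Rightarrow> ('m, 'n) tvec \<Rightarrow> real) \<Rightarrow>
     ('m \<Rightarrow> ('m, 'n) tvec \<Rightarrow> real) \<Rightarrow> 'm \<Rightarrow> ('m, 'n) tvec" where
  "sharp A g \<beta> x = (THE X. X \<in> tangent_space A x \<and> (\<forall>v\<in>tangent_space A x. \<beta> x v = g x X v))"

definition alpha_norm ::
    "('m \<Rightarrow> ('m, 'n::finite) tvec \<Rightarrow> ('m, 'n) tvec \<Rightarrow> real) \<Rightarrow> 'm \<Rightarrow> ('m, 'n) tvec \<Rightarrow> real" where
  "alpha_norm g x y = sqrt (g x y y)"

text \<open>The metric on covectors induced by \<open>g\<close> makes the musical isomorphism an isometry.\<close>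

definition form_norm ::
    "('m, 'n::finite) chart set \<Rightarrow> ('m \<Rightarrow> ('m, 'n) tvec \<Rightarrow> ('m, 'n) tvec \<Rightarrow> real) \<Rightarrow>
     ('m \<Rightarrow> ('m, 'n) tvec \<Rightarrow> real) \<Rightarrow> 'm \<Rightarrow> real" where
  "form_norm A g \<beta> x = alpha_norm g x (sharp A g \<beta> x)"

text \<open>Christoffel symbols \<open>\<Gamma>\<^sup>k\<^sub>i\<^sub>j\<close> of the Levi-Civita connection, in the chart \<open>c\<close>.\<close>

definition christoffel ::
    "('m, 'n::finite) chart set \<Rightarrow> ('m \<Rightarrow> ('m, 'n) tvec \<Rightarrow> ('m, 'n) tvec \<Rightarrow> real) \<Rightarrow>
     ('m, 'n) chart \<Rightarrow> 'n \<Rightarrow> 'n \<Rightarrow> 'n \<Rightarrow> real^'n \<Rightarrow> real" where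
  "christoffel A g c k i j p =
     (let G = metric_mat A g c in
      (\<Sum>l\<in>UNIV. matrix_inv (G p) $ k $ l *
         (pd i (\<lambda>q. G q $ j $ l) p + pd j (\<lambda>q. G q $ i $ l) p - pd l (\<lambda>q. G q $ i $ j) p)) / 2)"

definition parallel_form ::
    "('m, 'n::finite) chart set \<Rightarrow> ('m \<Rightarrow> ('m, 'n) tvec \<Rightarrow> ('m, 'n) tvec \<Rightarrow> real) \<Rightarrow>
     ('m \<Rightarrow> ('m, 'n) tvec \<Rightarrow> real) \<Rightarrow> bool" where
  "parallel_form A g \<beta> \<longleftrightarrow>
     (\<forall>c\<in>A. \<forall>p\<in>chart_image c. \<forall>i j.
        pd j (form_comp A \<beta> c i) p
          - (\<Sum>k\<in>UNIV. christoffel A g c k i j p * form_comp A \<beta> c k p) = 0)"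

text \<open>\<open>curv_comp A g c i j k l p\<close> is the component \<open>R\<^sup>i\<^sub>j\<^sub>k\<^sub>l\<close>, where
  \<open>R(\<partial>\<^sub>k, \<partial>\<^sub>l)\<partial>\<^sub>j = R\<^sup>i\<^sub>j\<^sub>k\<^sub>l \<partial>\<^sub>i\<close> and \<open>R(u,v) = \<nabla>\<^sub>u\<nabla>\<^sub>v - \<nabla>\<^sub>v\<nabla>\<^sub>u - \<nabla>\<^sub>[\<^sub>u\<^sub>,\<^sub>v\<^sub>]\<close>.\<close>

definition curv_comp ::
    "('m, 'n::finite) chart set \<Rightarrow> ('m \<Rightarrow> ('m, 'n) tvec \<Rightarrow> ('m, 'n) tvec \<Rightarrow> real) \<Rightarrow>
     ('m, 'n) chart \<Rightarrow> 'n \<Rightarrow> 'n \<Rightarrow> 'n \<Rightarrow> 'n \<Rightarrow> real^'n \<Rightarrow> real" where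
  "curv_comp A g c i j k l p =
     (let \<Gamma> = christoffel A g c in
      pd k (\<Gamma> i l j) p - pd l (\<Gamma> i k j) p
        + (\<Sum>m\<in>UNIV. \<Gamma> i k m p * \<Gamma> m l j p - \<Gamma> i l m p * \<Gamma> m k j p))"

text \<open>\<open>R(u,v)w\<close> at \<open>x\<close>, computed in a chart \<open>c\<close> around \<open>x\<close>.\<close>

definition riemann_curv ::
    "('m, 'n::finite) chart set \<Rightarrow> ('m \<Rightarrow> ('m, 'n) tvec \<Rightarrow> ('m, 'n) tvec \<Rightarrow> real) \<Rightarrow>
     ('m, 'n) chart \<Rightarrow> 'm \<Rightarrow> ('m, 'n) tvec \<Rightarrow> ('m, 'n) tvec \<Rightarrow> ('m, 'n) tvec \<Rightarrow> ('m, 'n) tvec" where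
  "riemann_curv A g c x u v w = tvec_of A x c
     (\<chi> i. \<Sum>j\<in>UNIV. \<Sum>k\<in>UNIV. \<Sum>l\<in>UNIV.
        curv_comp A g c i j k l (coord c x) * (w c $ j) * (u c $ k) * (v c $ l))"

definition sectional_curvature ::
    "('m, 'n::finite) chart set \<Rightarrow> ('m \<Rightarrow> ('m, 'n) tvec \<Rightarrow> ('m, 'n) tvec \<Rightarrow> real) \<Rightarrow>
     ('m, 'n) chart \<Rightarrow> 'm \<Rightarrow> ('m, 'n) tvec \<Rightarrow> ('m, 'n) tvec \<Rightarrow> real" where
  "sectional_curvature A g c x u v =
     g x (riemann_curv A g c x u v v) u / (g x u u * g x v v - (g x u v)\<^sup>2)"

section \<open>Finsler metrics\<close>

definition fundamental_tensor ::
    "('m \<Rightarrow> ('m, 'n::finite) tvec \<Rightarrow> real) \<Rightarrow> 'm \<Rightarrow>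
     ('m, 'n) tvec \<Rightarrow> ('m, 'n) tvec \<Rightarrow> ('m, 'n) tvec \<Rightarrow> real" where
  "fundamental_tensor F x y u v =
     deriv (\<lambda>s. deriv (\<lambda>t. (F x (tadd y (tadd (tscale s u) (tscale t v))))\<^sup>2) 0) 0 / 2"

definition local_rep ::
    "('m, 'n::finite) chart set \<Rightarrow> ('m \<Rightarrow> ('m, 'n) tvec \<Rightarrow> real) \<Rightarrow>
     ('m, 'n) chart \<Rightarrow> real^'n \<Rightarrow> real^'n \<Rightarrow> real" where
  "local_rep A F c p w = F (chart_inv c p) (tvec_of A (chart_inv c p) c w)"

definition finsler_metric ::
    "'m topology \<Rightarrow> ('m, 'n::finite) chart set \<Rightarrow> ('m \<Rightarrow> ('m, 'n) tvec \<Rightarrow> real) \<Rightarrow> bool" where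
  "finsler_metric M A F \<longleftrightarrow>
     (\<forall>c\<in>A. smooth_on (\<lambda>(p, w). local_rep A F c p w) (chart_image c \<times> (UNIV - {0}))) \<and>
     (\<forall>x\<in>topspace M. \<forall>y\<in>tangent_space A x.
        (\<forall>a\<ge>0. F x (tscale a y) = a * F x y) \<and>
        (y \<noteq> tzero \<longrightarrow> F x y > 0 \<and>
           (\<forall>u\<in>tangent_space A x. u \<noteq> tzero \<longrightarrow> fundamental_tensor F x y u u > 0)))"

definition fundamental_mat ::
    "('m, 'n::finite) chart set \<Rightarrow> ('m \<Rightarrow> ('m, 'n) tvec \<Rightarrow> real) \<Rightarrow>
     ('m, 'n) chart \<Rightarrow> real^'n \<Rightarrow> real^'n \<Rightarrow> real^'n^'n" where
  "fundamental_mat A F c p w =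
     (\<chi> i l. fundamental_tensor F (chart_inv c p) (tvec_of A (chart_inv c p) c w)
               (coord_vec A c p i) (coord_vec A c p l))"

definition spray ::
    "('m, 'n::finite) chart set \<Rightarrow> ('m \<Rightarrow> ('m, 'n) tvec \<Rightarrow> real) \<Rightarrow>
     ('m, 'n) chart \<Rightarrow> 'n \<Rightarrow> real^'n \<Rightarrow> real^'n \<Rightarrow> real" where
  "spray A F c i p w =
     (let L = (\<lambda>q v. (local_rep A F c q v)\<^sup>2) in
      (\<Sum>l\<in>UNIV. matrix_inv (fundamental_mat A F c p w) $ i $ l *
         ((\<Sum>k\<in>UNIV. pd l (\<lambda>v. pd k (\<lambda>q. L q v) p) w * (w $ k)) - pd l (\<lambda>q. L q w) p)) / 4)"

definition finsler_curv_comp ::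
    "('m, 'n::finite) chart set \<Rightarrow> ('m \<Rightarrow> ('m, 'n) tvec \<Rightarrow> real) \<Rightarrow>
     ('m, 'n) chart \<Rightarrow> 'n \<Rightarrow> 'n \<Rightarrow> real^'n \<Rightarrow> real^'n \<Rightarrow> real" where
  "finsler_curv_comp A F c i k p w =
     (let G = spray A F c in
      2 * pd k (\<lambda>q. G i q w) p
      - (\<Sum>j\<in>UNIV. (w $ j) * pd k (\<lambda>v. pd j (\<lambda>q. G i q v) p) w)
      + 2 * (\<Sum>j\<in>UNIV. G j p w * pd k (\<lambda>v. pd j (G i p) v) w)
      - (\<Sum>j\<in>UNIV. pd j (G i p) w * pd k (G j p) w))"

text \<open>\<open>R\<^sub>y(u)\<close> and the flag curvature at \<open>x\<close>, computed in a chart \<open>c\<close> around \<open>x\<close>.\<close>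

definition finsler_curv ::
    "('m, 'n::finite) chart set \<Rightarrow> ('m \<Rightarrow> ('m, 'n) tvec \<Rightarrow> real) \<Rightarrow>
     ('m, 'n) chart \<Rightarrow> 'm \<Rightarrow> ('m, 'n) tvec \<Rightarrow> ('m, 'n) tvec \<Rightarrow> ('m, 'n) tvec" where
  "finsler_curv A F c x y u = tvec_of A x c
     (\<chi> i. \<Sum>k\<in>UNIV. finsler_curv_comp A F c i k (coord c x) (y c) * (u c $ k))"

definition flag_curvature ::
    "('m, 'n::finite) chart set \<Rightarrow> ('m \<Rightarrow> ('m, 'n) tvec \<Rightarrow> real) \<Rightarrow>
     ('m, 'n) chart \<Rightarrow> 'm \<Rightarrow> ('m, 'n) tvec \<Rightarrow> ('m, 'n) tvec \<Rightarrow> real" where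
  "flag_curvature A F c x y u =
     fundamental_tensor F x y (finsler_curv A F c x y u) u /
     (fundamental_tensor F x y y y * fundamental_tensor F x y u u - (fundamental_tensor F x y y u)\<^sup>2)"

section \<open>General \<open>(\<alpha>,\<beta>)\<close>-metrics\<close>

text \<open>\<open>\<phi>\<close> is a function of \<open>(b\<^sup>2, s)\<close> on \<open>|s| \<le> b < b\<^sub>0\<close>. This set is not open, so smoothness means
  smoothness on an open neighbourhood; as the set is the closure (relative to \<open>b < b\<^sub>0\<close>) of its
  interior, the derivatives at its points do not depend on the extension.\<close>

definition phi_domain :: "ereal \<Rightarrow> (real \<times> real) set" where
  "phi_domain b0 = {(b\<^sup>2, s) | b s. \<bar>s\<bar> \<le> b \<and> ereal b < b0}"

definition d2 :: "(real \<Rightarrow> real \<Rightarrow> real) \<Rightarrow> real \<Rightarrow> real \<Rightarrow> real" where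
  "d2 \<phi> t s = deriv (\<phi> t) s"

text \<open>For \<open>y = 0\<close> the right-hand side of the formula for \<open>F\<close> is \<open>0\<close>. The usual inequalities on
  \<open>\<phi>\<close>, \<open>\<phi>\<^sub>2\<close>, \<open>\<phi>\<^sub>2\<^sub>2\<close> are not assumed separately: at the points
  \<open>(b\<^sup>2, s)\<close> that occur on \<open>M\<close> they express the positive definiteness contained in the last
  conjunct.\<close>

definition general_alpha_beta_metric ::
    "'m topology \<Rightarrow> ('m, 'n::finite) chart set \<Rightarrow>
     ('m \<Rightarrow> ('m, 'n) tvec \<Rightarrow> ('m, 'n) tvec \<Rightarrow> real) \<Rightarrow> ('m \<Rightarrow> ('m, 'n) tvec \<Rightarrow> real) \<Rightarrow>
     ereal \<Rightarrow> (real \<Rightarrow> real \<Rightarrow> real) \<Rightarrow> ('m \<Rightarrow> ('m, 'n) tvec \<Rightarrow> real) \<Rightarrow> bool" where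
  "general_alpha_beta_metric M A g \<beta> b0 \<phi> F \<longleftrightarrow>
     0 < b0 \<and>
     (\<forall>x\<in>topspace M. ereal (form_norm A g \<beta> x) < b0) \<and>
     (\<exists>U. open U \<and> phi_domain b0 \<subseteq> U \<and> smooth_on (\<lambda>(t, s). \<phi> t s) U) \<and>
     (\<forall>(t, s)\<in>phi_domain b0. \<phi> t s > 0) \<and>
     (\<forall>x\<in>topspace M. \<forall>y\<in>tangent_space A x.
        F x y = alpha_norm g x y * \<phi> ((form_norm A g \<beta> x)\<^sup>2) (\<beta> x y / alpha_norm g x y)) \<and>
     finsler_metric M A F"

end

theory Submission
  imports Defs
begin

text \<open>Let \<open>L = F\<^sup>2\<close>. At a point of a chart, \<open>L\<close> depends on the tangent vector \<open>w\<close> only through \<open>g(w,w)\<close> and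
\<open>\<beta>(w)\<close>, and on the point also through \<open>b\<^sup>2\<close>. When \<open>\<beta>\<close> is parallel, parallel transport preserves \<open>g\<close>, \<open>\<beta>\<close>
and \<open>b\<^sup>2\<close>, hence \<open>L\<close>. Infinitesimally, moving the base point in direction \<open>k\<close> changes \<open>L\<close> exactly as
moving \<open>w\<close> in direction \<open>\<Gamma>\<^sub>k w\<close> does (lemma \<open>has_dir_deriv_F_squared_base\<close>). Substituted into the definition
of the spray coefficients, this cancels everything except the fundamental tensor applied to
\<open>\<Gamma>(w,w)\<close>. So \<open>F\<close> and \<open>g\<close> have the same spray \<open>G\<^sup>i = \<Gamma>\<^sup>i(w,w) / 2\<close> (lemma \<open>spray_eq_conn\<close>), and the Finsler
curvature is \<open>R\<^sub>y(u) = R(u,y)y\<close> with the Riemannian curvature tensor on the right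
(lemma \<open>finsler_curv_comp_eq\<close>).

It remains to compare \<open>g\<^sup>F\<^sub>y(r,u)\<close> with \<open>g(r,u)\<close> for \<open>r = R(u,y)y\<close>. The fundamental tensor is
\<open>\<rho> g(r,u)\<close> plus terms that contain \<open>\<beta>(r)\<close> or \<open>g(y,r)\<close> as a factor. The first number vanishes because
a parallel form is annihilated by the curvature (lemma \<open>form_curv\<close>, from the symmetry of second derivatives of
\<open>\<beta>\<close>), the second because the curvature is skew (lemma \<open>curv_skew\<close>, from the symmetry of second
derivatives of \<open>g\<close>). This yields the first formula.

The second formula is algebra as long as \<open>\<phi> - s \<phi>\<^sub>2 \<noteq> 0\<close>. In dimension two that number can vanish; then its
right-hand side, in which \<open>D\<close> is a quotient by zero and so \<open>0\<close>, is correct only because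
\<open>K\<^sup>g = 0\<close>. Indeed positive definiteness of \<open>g\<^sup>F\<close> forces \<open>X\<close> into the plane of \<open>y\<close> and \<open>u\<close>, its component
along \<open>y\<close> is nonzero since \<open>\<phi> > 0\<close>, and so the plane is flat because the curvature annihilates \<open>\<beta>\<close>
(lemma \<open>curvature_zero_if_rho_zero\<close>).

All computations are made in the coordinates of the one chart \<open>c\<close>, where a tangent vector is an element of
\<open>real^'n\<close>.\<close>

section \<open>Directional derivatives\<close>

text \<open>The partial derivatives \<open>pd\<close> are values of \<open>deriv\<close>, which say something only where the derivative exists. The
relational form below carries existence along. It asks for differentiability along a single
line, which is all that \<open>pd\<close> sees.\<close>

definition has_dir_deriv :: "'a::real_normed_vector \<Rightarrow> ('a \<Rightarrow> 'b::real_normed_vector) \<Rightarrow> 'b \<Rightarrow> 'a \<Rightarrow> bool" where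
  "has_dir_deriv v f d p \<longleftrightarrow> ((\<lambda>t. f (p + t *\<^sub>R v)) has_vector_derivative d) (at 0)"

lemma has_dir_deriv_eq_rhs: "has_dir_deriv v f d p \<Longrightarrow> d = e \<Longrightarrow> has_dir_deriv v f e p"
  by simp

lemma has_dir_deriv_const: "has_dir_deriv v (\<lambda>q. k) 0 p"
  by (simp add: has_dir_deriv_def)

lemma has_dir_deriv_id: "has_dir_deriv v (\<lambda>q. q) v p"
  unfolding has_dir_deriv_def by (auto intro!: derivative_eq_intros simp: has_vector_derivative_def)

lemma has_dir_deriv_add:
  "has_dir_deriv v f d p \<Longrightarrow> has_dir_deriv v g e p \<Longrightarrow> has_dir_deriv v (\<lambda>q. f q + g q) (d + e) p"
  unfolding has_dir_deriv_def by (rule has_vector_derivative_add)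

lemma has_dir_deriv_diff:
  "has_dir_deriv v f d p \<Longrightarrow> has_dir_deriv v g e p \<Longrightarrow> has_dir_deriv v (\<lambda>q. f q - g q) (d - e) p"
  unfolding has_dir_deriv_def by (rule has_vector_derivative_diff)

lemma has_dir_deriv_sum:
  "(\<And>i. i \<in> I \<Longrightarrow> has_dir_deriv v (f i) (d i) p) \<Longrightarrow> has_dir_deriv v (\<lambda>q. \<Sum>i\<in>I. f i q) (\<Sum>i\<in>I. d i) p"
  unfolding has_dir_deriv_def by (rule has_vector_derivative_sum)

lemma has_dir_deriv_linear:
  "bounded_linear h \<Longrightarrow> has_dir_deriv v f d p \<Longrightarrow> has_dir_deriv v (\<lambda>q. h (f q)) (h d) p"
  unfolding has_dir_deriv_def by (rule bounded_linear.has_vector_derivative)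

lemma has_dir_deriv_bilinear:
  "bounded_bilinear h \<Longrightarrow> has_dir_deriv v f d p \<Longrightarrow> has_dir_deriv v g e p \<Longrightarrow>
    has_dir_deriv v (\<lambda>q. h (f q) (g q)) (h (f p) e + h d (g p)) p"
  unfolding has_dir_deriv_def by (drule (2) bounded_bilinear.has_vector_derivative) simp

lemma has_dir_deriv_mult:
  fixes f g :: "'a::real_normed_vector \<Rightarrow> real"
  shows "has_dir_deriv v f d p \<Longrightarrow> has_dir_deriv v g e p \<Longrightarrow>
    has_dir_deriv v (\<lambda>q. f q * g q) (f p * e + d * g p) p"
  by (rule has_dir_deriv_bilinear[OF bounded_bilinear_mult])

lemma has_dir_deriv_inner:
  "has_dir_deriv v f d p \<Longrightarrow> has_dir_deriv v g e p \<Longrightarrow>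
    has_dir_deriv v (\<lambda>q. f q \<bullet> g q) (f p \<bullet> e + d \<bullet> g p) p"
  by (rule has_dir_deriv_bilinear[OF bounded_bilinear_inner])

lemma bounded_bilinear_matrix_vector_mult:
  "bounded_bilinear (\<lambda>(A::real^'n^'m) x. A *v x)"
  by (simp add: bilinear_conv_bounded_bilinear[symmetric] bilinear_def linear_iff algebra_simps
      scaleR_matrix_vector_assoc[symmetric])

lemma has_dir_deriv_matrix_vector:
  fixes B :: "'a::real_normed_vector \<Rightarrow> real^'n^'m"
  shows "has_dir_deriv v B d p \<Longrightarrow> has_dir_deriv v f e p \<Longrightarrow>
    has_dir_deriv v (\<lambda>q. B q *v f q) (B p *v e + d *v f p) p"
  by (rule has_dir_deriv_bilinear[OF bounded_bilinear_matrix_vector_mult])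

lemma has_dir_deriv_nth:
  fixes f :: "'a::real_normed_vector \<Rightarrow> 'b::real_normed_vector^'n"
  shows "has_dir_deriv v f d p \<Longrightarrow> has_dir_deriv v (\<lambda>q. f q $ i) (d $ i) p"
  by (rule has_dir_deriv_linear[OF bounded_linear_vec_nth])

lemma has_vector_derivative_componentwise_vec:
  fixes f :: "real \<Rightarrow> 'b::real_normed_vector^'n"
  assumes "\<And>i. ((\<lambda>t. f t $ i) has_vector_derivative d $ i) (at a)"
  shows "(f has_vector_derivative d) (at a)"
  using assms unfolding has_vector_derivative_def has_derivative_def
  by (auto intro!: bounded_linear_scaleR_left vec_tendstoI)

lemma has_dir_deriv_vecI:
  fixes f :: "'a::real_normed_vector \<Rightarrow> 'b::real_normed_vector^'n"
  assumes "\<And>i. has_dir_deriv v (\<lambda>q. f q $ i) (d $ i) p"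
  shows "has_dir_deriv v f d p"
  using assms unfolding has_dir_deriv_def by (intro has_vector_derivative_componentwise_vec)

lemma has_dir_deriv_real:
  fixes f :: "'a::real_normed_vector \<Rightarrow> real"
  shows "has_dir_deriv v f d p \<longleftrightarrow> ((\<lambda>t. f (p + t *\<^sub>R v)) has_real_derivative d) (at 0)"
  by (simp add: has_dir_deriv_def has_real_derivative_iff_has_vector_derivative)

lemma has_dir_deriv_compose_real:
  fixes f :: "'a::real_normed_vector \<Rightarrow> real"
  assumes "has_dir_deriv v f d p" "(h has_real_derivative e) (at (f p))"
  shows "has_dir_deriv v (\<lambda>q. h (f q)) (d * e) p"
  using assms DERIV_chain2[of h e "\<lambda>t. f (p + t *\<^sub>R v)" 0 d UNIV] unfolding has_dir_deriv_real
  by (simp add: mult.commute)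

lemma has_dir_deriv_of_has_derivative:
  assumes "(f has_derivative f') (at p)"
  shows "has_dir_deriv v f (f' v) p"
proof -
  have "((\<lambda>t. p + t *\<^sub>R v) has_derivative (\<lambda>t. t *\<^sub>R v)) (at 0)"
    by (auto intro!: derivative_eq_intros)
  from has_derivative_compose[OF this, of f f'] assms
  show ?thesis
    by (simp add: has_dir_deriv_def has_vector_derivative_def linear_simps bounded_linear.linear
        has_derivative_linear[THEN linear_scale] )
qed

lemma has_dir_deriv_unique: "has_dir_deriv v f d p \<Longrightarrow> has_dir_deriv v f e p \<Longrightarrow> d = e"
  unfolding has_dir_deriv_def by (rule vector_derivative_unique_at)

lemma pd_eqI: "has_dir_deriv (axis i 1) f d p \<Longrightarrow> pd i f p = d"
  unfolding has_dir_deriv_real pd_def by (rule DERIV_imp_deriv)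

lemma eventually_line_in_open:
  fixes p v :: "'a::real_normed_vector"
  assumes "open S" "p \<in> S"
  shows "eventually (\<lambda>t. p + t *\<^sub>R v \<in> S) (nhds (0::real))"
proof -
  have "((\<lambda>t. p + t *\<^sub>R v) \<longlongrightarrow> p + 0 *\<^sub>R v) (nhds 0)"
    by (intro tendsto_intros filterlim_ident)
  then have "((\<lambda>t. p + t *\<^sub>R v) \<longlongrightarrow> p) (nhds 0)" by simp
  then show ?thesis using assms topological_tendstoD by blast
qed

lemma has_dir_deriv_cong_open:
  assumes "open S" "p \<in> S" "\<And>q. q \<in> S \<Longrightarrow> f q = g q"
  shows "has_dir_deriv v f d p \<longleftrightarrow> has_dir_deriv v g d p"
  unfolding has_dir_deriv_def
  using eventually_mono[OF eventually_line_in_open[OF assms(1,2), of v]] assms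
  by (intro has_vector_derivative_cong_ev) auto

lemma pd_cong_open:
  assumes "open S" "p \<in> S" "\<And>q. q \<in> S \<Longrightarrow> f q = g q"
  shows "pd i f p = pd i g p"
  unfolding pd_def
  using eventually_mono[OF eventually_line_in_open[OF assms(1,2), of "axis i 1"]] assms
  by (intro deriv_cong_ev) auto

section \<open>Symmetry of second derivatives\<close>

lemma smooth_on_continuous: "smooth_on f S \<Longrightarrow> continuous_on S f"
  unfolding smooth_on_def by (metis Ck_on.simps(1))

lemma smooth_on_differentiable: "smooth_on f S \<Longrightarrow> p \<in> S \<Longrightarrow> f differentiable (at p)"
  unfolding smooth_on_def by (metis Ck_on.simps(2))

lemma smooth_on_frechet: "smooth_on f S \<Longrightarrow> smooth_on (\<lambda>p. frechet_derivative f (at p) v) S"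
  unfolding smooth_on_def by (metis Ck_on.simps(2))

lemma smooth_on_has_dir_deriv:
  "smooth_on f S \<Longrightarrow> p \<in> S \<Longrightarrow> has_dir_deriv v f (frechet_derivative f (at p) v) p"
  by (intro has_dir_deriv_of_has_derivative) (simp add: frechet_derivative_works[symmetric] smooth_on_differentiable)

text \<open>Translates between derivatives at \<open>0\<close> along a line through a moving point and derivatives at a moving parameter
along a fixed line, the form in which the mean value theorem and one-variable calculus apply.\<close>

lemma has_dir_deriv_shift:
  fixes f :: "'a::real_normed_vector \<Rightarrow> real"
  assumes "has_dir_deriv v f d (p + a *\<^sub>R v)"
  shows "((\<lambda>t. f (p + t *\<^sub>R v)) has_real_derivative d) (at a)"
  using DERIV_at_within_shift[of "\<lambda>t. f (p + t *\<^sub>R v)" d a 0 UNIV] assms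
  by (simp add: has_dir_deriv_real algebra_simps)

text \<open>Two applications of the mean value theorem to the second difference of \<open>f\<close> over the
  parallelogram spanned by \<open>h u\<close> and \<open>h v\<close>: first along \<open>u\<close> to the difference of \<open>f\<close> across \<open>h v\<close>, then
  along \<open>v\<close> to the derivative \<open>fu\<close>.\<close>

lemma second_difference_mean_value:
  fixes f :: "'a::real_normed_vector \<Rightarrow> real"
  assumes h: "0 < h"
    and fu: "\<And>s t. 0 \<le> s \<Longrightarrow> s \<le> h \<Longrightarrow> 0 \<le> t \<Longrightarrow> t \<le> h \<Longrightarrow>
        has_dir_deriv u f (fu (p + s *\<^sub>R u + t *\<^sub>R v)) (p + s *\<^sub>R u + t *\<^sub>R v)"
    and fuv: "\<And>s t. 0 \<le> s \<Longrightarrow> s \<le> h \<Longrightarrow> 0 \<le> t \<Longrightarrow> t \<le> h \<Longrightarrow>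
        has_dir_deriv v fu (fuv (p + s *\<^sub>R u + t *\<^sub>R v)) (p + s *\<^sub>R u + t *\<^sub>R v)"
  shows "\<exists>s t. 0 < s \<and> s < h \<and> 0 < t \<and> t < h \<and>
    f (p + h *\<^sub>R u + h *\<^sub>R v) - f (p + h *\<^sub>R u) - f (p + h *\<^sub>R v) + f p
      = h * h * fuv (p + s *\<^sub>R u + t *\<^sub>R v)"
proof -
  define k where "k s = f ((p + h *\<^sub>R v) + s *\<^sub>R u) - f (p + s *\<^sub>R u)" for s
  have "DERIV k s :> fu (p + s *\<^sub>R u + h *\<^sub>R v) - fu (p + s *\<^sub>R u)" if "0 \<le> s" "s \<le> h" for s
    unfolding k_def using fu[of s h] fu[of s 0] that h
    by (intro DERIV_diff has_dir_deriv_shift) (simp_all add: algebra_simps)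
  from MVT2[OF h this] obtain s where s: "0 < s" "s < h"
    "k h - k 0 = h * (fu (p + s *\<^sub>R u + h *\<^sub>R v) - fu (p + s *\<^sub>R u))" by auto
  have "DERIV (\<lambda>t. fu (p + s *\<^sub>R u + t *\<^sub>R v)) t :> fuv (p + s *\<^sub>R u + t *\<^sub>R v)"
    if "0 \<le> t" "t \<le> h" for t
    using fuv[of s t] that s by (intro has_dir_deriv_shift) auto
  from MVT2[OF h this] obtain t where t: "0 < t" "t < h"
    "fu (p + s *\<^sub>R u + h *\<^sub>R v) - fu (p + s *\<^sub>R u) = h * fuv (p + s *\<^sub>R u + t *\<^sub>R v)" by auto
  have "f (p + h *\<^sub>R u + h *\<^sub>R v) - f (p + h *\<^sub>R u) - f (p + h *\<^sub>R v) + f p = k h - k 0"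
    by (simp add: k_def algebra_simps)
  then show ?thesis using s t by auto
qed

text \<open>The second difference over a small parallelogram is symmetric in \<open>u\<close> and \<open>v\<close>, so by the mean value
theorem it is \<open>h\<^sup>2\<close> times a value of either mixed derivative. If these differed at \<open>p\<close>, continuity would keep them
apart on a whole parallelogram.\<close>

lemma mixed_derivatives_commute:
  fixes f :: "'a::real_normed_vector \<Rightarrow> real"
  assumes S: "open S" "p \<in> S"
    and fu: "\<And>q. q \<in> S \<Longrightarrow> has_dir_deriv u f (fu q) q" and fv: "\<And>q. q \<in> S \<Longrightarrow> has_dir_deriv v f (fv q) q"
    and fuv: "\<And>q. q \<in> S \<Longrightarrow> has_dir_deriv v fu (fuv q) q"
    and fvu: "\<And>q. q \<in> S \<Longrightarrow> has_dir_deriv u fv (fvu q) q"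
    and cont: "continuous_on S fuv" "continuous_on S fvu"
  shows "fuv p = fvu p"
proof (rule ccontr)
  assume ne: "fuv p \<noteq> fvu p"
  define e where "e = \<bar>fuv p - fvu p\<bar> / 2"
  have e: "e > 0" using ne by (simp add: e_def)
  have "isCont fuv p" "isCont fvu p"
    using cont S continuous_on_eq_continuous_at by blast+
  then have c: "(fuv \<longlongrightarrow> fuv p) (nhds p)" "(fvu \<longlongrightarrow> fvu p) (nhds p)"
    by (simp_all add: isCont_def tendsto_at_iff_tendsto_nhds)
  have "\<forall>\<^sub>F q in nhds p. q \<in> S \<and> dist (fuv q) (fuv p) < e \<and> dist (fvu q) (fvu p) < e"
    using c[THEN tendstoD, OF e] S by (intro eventually_conj eventually_nhds_in_open) auto
  then obtain d where d: "d > 0"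
    "\<And>q. dist q p < d \<Longrightarrow> q \<in> S \<and> dist (fuv q) (fuv p) < e \<and> dist (fvu q) (fvu p) < e"
    unfolding eventually_nhds_metric by blast
  \<comment> \<open>small enough for the parallelogram to lie in the ball of radius \<open>d\<close>\<close>
  define h where "h = d / (2 * (norm u + norm v + 1))"
  have den: "0 < norm u + norm v + 1" by (simp add: add_nonneg_pos)
  have h: "h > 0" using d den unfolding h_def by simp
  have near: "dist (p + s *\<^sub>R u + t *\<^sub>R v) p < d" if "0 \<le> s" "s \<le> h" "0 \<le> t" "t \<le> h" for s t
  proof -
    have "dist (p + s *\<^sub>R u + t *\<^sub>R v) p \<le> s * norm u + t * norm v"
      using norm_triangle_ineq[of "s *\<^sub>R u" "t *\<^sub>R v"] that by (simp add: dist_norm add.assoc)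
    also have "\<dots> \<le> h * norm u + h * norm v"
      using that by (intro add_mono mult_right_mono) auto
    also have "\<dots> \<le> h * (norm u + norm v + 1)" using h by (simp add: algebra_simps)
    also have "\<dots> = d / 2" using den by (simp add: h_def field_simps)
    finally show ?thesis using d by simp
  qed
  from second_difference_mean_value[OF h, of u f fu p v fuv] fu fuv near d
  obtain s t where st: "0 < s" "s < h" "0 < t" "t < h"
    "f (p + h *\<^sub>R u + h *\<^sub>R v) - f (p + h *\<^sub>R u) - f (p + h *\<^sub>R v) + f p
      = h * h * fuv (p + s *\<^sub>R u + t *\<^sub>R v)" by blast
  have swap: "p + s *\<^sub>R v + t *\<^sub>R u = p + t *\<^sub>R u + s *\<^sub>R v" for s t
    by (simp add: algebra_simps)
  from second_difference_mean_value[OF h, of v f fv p u fvu] fv fvu near d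
  obtain s' t' where st': "0 < s'" "s' < h" "0 < t'" "t' < h"
    "f (p + h *\<^sub>R v + h *\<^sub>R u) - f (p + h *\<^sub>R v) - f (p + h *\<^sub>R u) + f p
      = h * h * fvu (p + t' *\<^sub>R u + s' *\<^sub>R v)" unfolding swap by blast
  have "h * h * fuv (p + s *\<^sub>R u + t *\<^sub>R v) = h * h * fvu (p + t' *\<^sub>R u + s' *\<^sub>R v)"
    using st(5) st'(5) unfolding swap by linarith
  then have "fuv (p + s *\<^sub>R u + t *\<^sub>R v) = fvu (p + t' *\<^sub>R u + s' *\<^sub>R v)"
    using h by simp
  moreover have "dist (fuv (p + s *\<^sub>R u + t *\<^sub>R v)) (fuv p) < e"
      "dist (fvu (p + t' *\<^sub>R u + s' *\<^sub>R v)) (fvu p) < e"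
    using d(2)[OF near] st st' by (meson less_imp_le)+
  ultimately have "\<bar>fuv p - fvu p\<bar> < 2 * e"
    by (simp add: dist_real_def)
  then show False by (simp add: e_def)
qed

lemma smooth_second_derivative_symmetric:
  fixes f :: "'a::real_normed_vector \<Rightarrow> 'b::euclidean_space"
  assumes f: "smooth_on f S" and S: "open S" "p \<in> S"
  shows "frechet_derivative (\<lambda>q. frechet_derivative f (at q) u) (at p) v
       = frechet_derivative (\<lambda>q. frechet_derivative f (at q) v) (at p) u"
proof (rule euclidean_eqI)
  fix k :: 'b
  have deriv: "has_dir_deriv w (\<lambda>q. h q \<bullet> k) (frechet_derivative h (at q) w \<bullet> k) q"
    if "smooth_on h S" "q \<in> S" for h :: "'a \<Rightarrow> 'b" and w q
    using that by (intro has_dir_deriv_linear[OF bounded_linear_inner_left] smooth_on_has_dir_deriv)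
  have cont: "continuous_on S (\<lambda>q. h q \<bullet> k)" if "smooth_on h S" for h :: "'a \<Rightarrow> 'b"
    using that by (intro continuous_on_inner continuous_on_const smooth_on_continuous)
  show "frechet_derivative (\<lambda>q. frechet_derivative f (at q) u) (at p) v \<bullet> k
      = frechet_derivative (\<lambda>q. frechet_derivative f (at q) v) (at p) u \<bullet> k"
    by (rule mixed_derivatives_commute[OF S, of u "\<lambda>q. f q \<bullet> k" "\<lambda>q. frechet_derivative f (at q) u \<bullet> k"
          v "\<lambda>q. frechet_derivative f (at q) v \<bullet> k"
          "\<lambda>q. frechet_derivative (\<lambda>q. frechet_derivative f (at q) u) (at q) v \<bullet> k"
          "\<lambda>q. frechet_derivative (\<lambda>q. frechet_derivative f (at q) v) (at q) u \<bullet> k"])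
       (intro deriv cont smooth_on_frechet f; assumption)+
qed

section \<open>The inverse of a differentiable family of matrices\<close>

lemma invertible_matrix_inv:
  fixes B :: "real^'n^'n"
  assumes "invertible B"
  shows "B ** matrix_inv B = mat 1" "matrix_inv B ** B = mat 1"
  using assms someI_ex[of "\<lambda>C. B ** C = mat 1 \<and> C ** B = mat 1"]
  unfolding invertible_def matrix_inv_def by blast+

text \<open>Cramer's rule makes the entries of the inverse rational functions of the entries of the matrix, and this
gives their differentiability.\<close>

lemma matrix_inv_cramer:
  fixes B :: "real^'n^'n"
  assumes "invertible B"
  shows "matrix_inv B $ k $ l = det (\<chi> i j. if j = k then axis l 1 $ i else B $ i $ j) / det B"
proof -
  have "B *v (matrix_inv B *v axis l 1) = axis l 1"
    using invertible_matrix_inv[OF assms] by (simp add: matrix_vector_mul_assoc)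
  then have "matrix_inv B *v axis l 1
      = (\<chi> k. det (\<chi> i j. if j = k then axis l 1 $ i else B $ i $ j) / det B)"
    using cramer[of B] assms invertible_det_nz by blast
  then have "(matrix_inv B *v axis l 1) $ k = det (\<chi> i j. if j = k then axis l 1 $ i else B $ i $ j) / det B"
    by simp
  then show ?thesis by (simp add: matrix_vector_mult_basis column_def)
qed

lemma differentiable_prod:
  fixes f :: "'i \<Rightarrow> real \<Rightarrow> real"
  assumes "\<And>i. i \<in> I \<Longrightarrow> f i differentiable (at x)"
  shows "(\<lambda>t. \<Prod>i\<in>I. f i t) differentiable (at x)"
  using assms by (induction I rule: infinite_finite_induct) auto

lemma differentiable_det:
  fixes f :: "real \<Rightarrow> real^'n^'n"
  assumes "\<And>i j. (\<lambda>t. f t $ i $ j) differentiable (at x)"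
  shows "(\<lambda>t. det (f t)) differentiable (at x)"
proof -
  have "(\<lambda>t. of_int (sign \<pi>) * (\<Prod>i\<in>UNIV. f t $ i $ \<pi> i)) differentiable (at x)" for \<pi>
    by (intro differentiable_mult differentiable_const differentiable_prod assms)
  then show ?thesis
    unfolding det_def by (intro differentiable_sum) (auto simp: finite_permutations)
qed

lemma matrix_inv_has_dir_deriv:
  fixes B :: "'a::real_normed_vector \<Rightarrow> real^'n^'n"
  assumes S: "open S" "p \<in> S" and inv: "\<And>q. q \<in> S \<Longrightarrow> invertible (B q)" and B: "has_dir_deriv v B d p"
  shows "\<exists>e. has_dir_deriv v (\<lambda>q. matrix_inv (B q)) e p"
proof -
  let ?c = "\<lambda>k l q. det (\<chi> i j. if j = k then axis l 1 $ i else B q $ i $ j) / det (B q)"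
  have diff: "(\<lambda>t. B (p + t *\<^sub>R v) $ i $ j) differentiable (at 0)" for i j
    using has_dir_deriv_nth[OF has_dir_deriv_nth[OF B]] unfolding has_dir_deriv_real
    using real_differentiable_def by blast
  have ex: "\<exists>e. has_dir_deriv v (?c k l) e p" for k l
    unfolding has_dir_deriv_real real_differentiable_def[symmetric]
  proof (intro differentiable_divide differentiable_det)
    show "(\<lambda>t. (\<chi> i j. if j = k then axis l 1 $ i else B (p + t *\<^sub>R v) $ i $ j) $ i $ j) differentiable at 0"
      for i j using diff by (cases "j = k") auto
    show "(\<lambda>t. B (p + t *\<^sub>R v) $ i $ j) differentiable (at 0)" for i j by (rule diff)
    show "det (B (p + 0 *\<^sub>R v)) \<noteq> 0" using inv S invertible_det_nz by auto
  qed
  define e where "e k l = (SOME e. has_dir_deriv v (?c k l) e p)" for k l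
  have e: "has_dir_deriv v (?c k l) (e k l) p" for k l
    unfolding e_def by (rule someI_ex[OF ex])
  have "has_dir_deriv v (\<lambda>q. matrix_inv (B q)) (\<chi> k l. e k l) p"
  proof (intro has_dir_deriv_vecI)
    fix k l
    show "has_dir_deriv v (\<lambda>q. matrix_inv (B q) $ k $ l) ((\<chi> k l. e k l) $ k $ l) p"
      using e[of k l] matrix_inv_cramer[OF inv]
      by (subst has_dir_deriv_cong_open[OF S, of _ "?c k l"]) auto
  qed
  then show ?thesis by blast
qed

section \<open>Levi-Civita connection in a chart\<close>

text \<open>The open set \<open>S\<close> will be the image of the chart. The matrices of \<open>conn\<close> are the connection forms, that is
\<open>\<nabla>\<^sub>k w = \<partial>\<^sub>k w + conn k *v w\<close>. In this notation the contractions with Christoffel symbols are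
matrix products.\<close>

locale chart_metric =
  fixes A :: "('m, 'n::finite) chart set"
    and g :: "'m \<Rightarrow> ('m, 'n) tvec \<Rightarrow> ('m, 'n) tvec \<Rightarrow> real"
    and c :: "('m, 'n) chart"
    and S :: "(real^'n) set"
  assumes open_S: "open S"
    and smooth_metric: "smooth_on (metric_mat A g c) S"
    and metric_sym: "q \<in> S \<Longrightarrow> metric_mat A g c q $ i $ j = metric_mat A g c q $ j $ i"
    and metric_pos: "q \<in> S \<Longrightarrow> w \<noteq> 0 \<Longrightarrow> w \<bullet> (metric_mat A g c q *v w) > 0"
begin

abbreviation G :: "real^'n \<Rightarrow> real^'n^'n" where
  "G \<equiv> metric_mat A g c"

abbreviation \<Gamma> :: "'n \<Rightarrow> 'n \<Rightarrow> 'n \<Rightarrow> real^'n \<Rightarrow> real" where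
  "\<Gamma> \<equiv> christoffel A g c"

definition DG :: "'n \<Rightarrow> real^'n \<Rightarrow> real^'n^'n" where
  "DG k q = frechet_derivative G (at q) (axis k 1)"

definition conn :: "'n \<Rightarrow> real^'n \<Rightarrow> real^'n^'n" where
  "conn k q = (\<chi> m i. \<Gamma> m k i q)"

definition Dconn :: "'n \<Rightarrow> 'n \<Rightarrow> real^'n \<Rightarrow> real^'n^'n" where
  "Dconn l k q = (\<chi> m i. pd l (\<Gamma> m k i) q)"

definition curv_mat :: "'n \<Rightarrow> 'n \<Rightarrow> real^'n \<Rightarrow> real^'n^'n" where
  "curv_mat k l q = (\<chi> i j. curv_comp A g c i j k l q)"

lemma inner_metric_sym: "q \<in> S \<Longrightarrow> v \<bullet> (G q *v w) = w \<bullet> (G q *v v)"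
proof -
  assume "q \<in> S"
  then have "transpose (G q) = G q"
    by (simp add: transpose_def vec_eq_iff metric_sym[of q])
  then show ?thesis
    by (metis dot_lmul_matrix inner_commute vector_transpose_matrix)
qed

lemma metric_invertible: "q \<in> S \<Longrightarrow> invertible (G q)"
  unfolding invertible_left_inverse matrix_left_invertible_ker
  using metric_pos by fastforce

lemma has_dir_deriv_metric: "q \<in> S \<Longrightarrow> has_dir_deriv (axis k 1) G (DG k q) q"
  unfolding DG_def by (rule smooth_on_has_dir_deriv[OF smooth_metric])

lemma pd_metric: "q \<in> S \<Longrightarrow> pd k (\<lambda>q. G q $ i $ j) q = DG k q $ i $ j"
  by (intro pd_eqI has_dir_deriv_nth has_dir_deriv_metric)

lemma DG_sym: "q \<in> S \<Longrightarrow> DG k q $ i $ j = DG k q $ j $ i"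
  using pd_cong_open[OF open_S, of q "\<lambda>q. G q $ i $ j" "\<lambda>q. G q $ j $ i" k]
  by (simp add: pd_metric metric_sym)

lemma christoffel_eq:
  "q \<in> S \<Longrightarrow> \<Gamma> k i j q = (\<Sum>l\<in>UNIV. matrix_inv (G q) $ k $ l *
      (DG i q $ j $ l + DG j q $ i $ l - DG l q $ i $ j)) / 2"
  by (simp add: christoffel_def pd_metric)

lemma christoffel_sym: "q \<in> S \<Longrightarrow> \<Gamma> k i j q = \<Gamma> k j i q"
  by (simp add: christoffel_eq DG_sym[of q _ i j] add.commute)

text \<open>Lowering the upper index of the Christoffel symbols cancels the inverse matrix in their definition.\<close>

lemma metric_times_conn:
  assumes q: "q \<in> S"
  shows "(G q ** conn k q) $ m $ i = (DG k q $ i $ m + DG i q $ k $ m - DG m q $ k $ i) / 2"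
proof -
  define z where "z = (\<chi> l. (DG k q $ i $ l + DG i q $ k $ l - DG l q $ k $ i) / 2)"
  have "(\<chi> m. \<Gamma> m k i q) = matrix_inv (G q) *v z"
    by (simp add: vec_eq_iff z_def christoffel_eq[OF q] matrix_vector_mult_def sum_divide_distrib)
  then have "G q *v (\<chi> m. \<Gamma> m k i q) = z"
    by (simp add: matrix_vector_mul_assoc invertible_matrix_inv[OF metric_invertible[OF q]])
  then have "(G q *v (\<chi> m. \<Gamma> m k i q)) $ m = z $ m" by simp
  then show ?thesis
    by (simp add: z_def matrix_matrix_mult_def matrix_vector_mult_def conn_def)
qed

text \<open>\<open>\<nabla>g = 0\<close>. The symmetric part of \<open>G ** conn k\<close> is half of \<open>\<partial>\<^sub>k G\<close>: in the lowered Christoffel symbols the other two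
derivatives of the metric are exchanged by the transposition and cancel.\<close>

lemma metric_compatible:
  assumes q: "q \<in> S"
  shows "v \<bullet> (DG k q *v w) = (conn k q *v v) \<bullet> (G q *v w) + v \<bullet> (G q *v (conn k q *v w))"
proof -
  let ?B = "G q ** conn k q"
  have "DG k q = transpose ?B + ?B"
    by (simp add: vec_eq_iff transpose_def metric_times_conn[OF q] DG_sym[OF q, of k] field_simps)
  then have "v \<bullet> (DG k q *v w) = v \<bullet> (transpose ?B *v w) + v \<bullet> (?B *v w)"
    by (simp add: matrix_vector_mult_add_rdistrib inner_right_distrib del: transpose_matrix_vector)
  also have "v \<bullet> (transpose ?B *v w) = w \<bullet> (?B *v v)"
    by (metis dot_lmul_matrix inner_commute transpose_matrix_vector)
  also have "w \<bullet> (?B *v v) = (conn k q *v v) \<bullet> (G q *v w)"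
    by (metis matrix_vector_mul_assoc inner_metric_sym[OF q])
  finally show ?thesis by (simp add: matrix_vector_mul_assoc)
qed

lemma has_dir_deriv_DG:
  "q \<in> S \<Longrightarrow> \<exists>d. has_dir_deriv v (DG k) d q"
  unfolding DG_def using smooth_on_has_dir_deriv[OF smooth_on_frechet[OF smooth_metric]] by blast

lemma has_dir_deriv_metric_inv: "q \<in> S \<Longrightarrow> \<exists>d. has_dir_deriv (axis l 1) (\<lambda>q. matrix_inv (G q)) d q"
  using matrix_inv_has_dir_deriv[OF open_S _ metric_invertible has_dir_deriv_metric] by blast

lemma has_dir_deriv_christoffel:
  assumes q: "q \<in> S"
  shows "has_dir_deriv (axis l 1) (\<Gamma> k i j) (pd l (\<Gamma> k i j) q) q"
proof -
  obtain e where e: "has_dir_deriv (axis l 1) (\<lambda>q. matrix_inv (G q)) e q"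
    using has_dir_deriv_metric_inv[OF q] by blast
  define d where "d k = (SOME d. has_dir_deriv (axis l 1) (DG k) d q)" for k
  have d: "has_dir_deriv (axis l 1) (DG k) (d k) q" for k
    unfolding d_def by (rule someI_ex[OF has_dir_deriv_DG[OF q]])
  have "has_dir_deriv (axis l 1) (\<lambda>q. inverse 2 * (\<Sum>m\<in>UNIV. matrix_inv (G q) $ k $ m *
      (DG i q $ j $ m + DG j q $ i $ m - DG m q $ i $ j)))
     (inverse 2 * (\<Sum>m\<in>UNIV. matrix_inv (G q) $ k $ m * (d i $ j $ m + d j $ i $ m - d m $ i $ j)
        + e $ k $ m * (DG i q $ j $ m + DG j q $ i $ m - DG m q $ i $ j))) q"
    by (intro has_dir_deriv_linear[OF bounded_linear_mult_right] has_dir_deriv_sum has_dir_deriv_mult has_dir_deriv_add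
        has_dir_deriv_diff has_dir_deriv_nth e d)
  then have "\<exists>z. has_dir_deriv (axis l 1) (\<Gamma> k i j) z q"
    by (subst has_dir_deriv_cong_open[OF open_S q, of _ "\<lambda>q. inverse 2 * (\<Sum>m\<in>UNIV. matrix_inv (G q) $ k $ m *
      (DG i q $ j $ m + DG j q $ i $ m - DG m q $ i $ j))"]) (auto simp: christoffel_eq field_simps)
  then show ?thesis using pd_eqI by metis
qed

lemma has_dir_deriv_conn:
  "q \<in> S \<Longrightarrow> has_dir_deriv (axis l 1) (conn k) (Dconn l k q) q"
  by (intro has_dir_deriv_vecI) (simp add: conn_def Dconn_def has_dir_deriv_christoffel)

lemma curv_eq: "curv_mat k l q = Dconn k l q - Dconn l k q + conn k q ** conn l q - conn l q ** conn k q"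
  by (simp add: vec_eq_iff curv_mat_def curv_comp_def Dconn_def conn_def matrix_matrix_mult_def
      sum_subtractf Let_def)

lemma curv_apply: "curv_mat k l q *v w = Dconn k l q *v w - Dconn l k q *v w
    + conn k q *v (conn l q *v w) - conn l q *v (conn k q *v w)"
  by (simp add: curv_eq matrix_vector_mult_add_rdistrib matrix_vector_mult_diff_rdistrib
      matrix_vector_mul_assoc)

text \<open>Metric compatibility gives \<open>\<partial>\<^sub>l g(w,w) = 2 g(\<Gamma>\<^sub>l w, w)\<close> for a vector \<open>w\<close> with constant components.
Differentiating once more and exchanging \<open>k\<close> and \<open>l\<close>, the left-hand sides agree and the difference of the
right-hand sides is twice \<open>g(R w, w)\<close>; the term \<open>g(\<Gamma>\<^sub>l w, \<Gamma>\<^sub>k w)\<close> is symmetric.\<close>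

lemma curv_skew:
  assumes p: "p \<in> S"
  shows "w \<bullet> (G p *v (curv_mat k l p *v w)) = 0"
proof -
  define H where "H k l = frechet_derivative (DG l) (at p) (axis k 1)" for k l
  have Hsym: "H k l = H l k" for k l
    unfolding H_def DG_def by (rule smooth_second_derivative_symmetric[OF smooth_metric open_S p])
  have second: "w \<bullet> (H k l *v w) = 2 * ((Dconn k l p *v w) \<bullet> (G p *v w)
      + (conn k p *v (conn l p *v w)) \<bullet> (G p *v w) + (conn l p *v w) \<bullet> (G p *v (conn k p *v w)))"
    for k l
  proof -
    have "has_dir_deriv (axis k 1) (DG l) (H k l) p"
      unfolding H_def DG_def by (intro smooth_on_has_dir_deriv[OF smooth_on_frechet[OF smooth_metric] p])
    then have "has_dir_deriv (axis k 1) (\<lambda>q. w \<bullet> (DG l q *v w))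
        (w \<bullet> (DG l p *v 0 + H k l *v w) + 0 \<bullet> (DG l p *v w)) p"
      by (intro has_dir_deriv_inner has_dir_deriv_matrix_vector has_dir_deriv_const)
    then have 1: "has_dir_deriv (axis k 1) (\<lambda>q. w \<bullet> (DG l q *v w)) (w \<bullet> (H k l *v w)) p" by simp
    have "has_dir_deriv (axis k 1) (\<lambda>q. 2 * ((conn l q *v w) \<bullet> (G q *v w)))
       (2 * ((conn l p *v w) \<bullet> (G p *v 0 + DG k p *v w)
           + (conn l p *v 0 + Dconn k l p *v w) \<bullet> (G p *v w))) p"
      by (intro has_dir_deriv_linear[OF bounded_linear_mult_right] has_dir_deriv_inner has_dir_deriv_matrix_vector
         has_dir_deriv_const has_dir_deriv_metric has_dir_deriv_conn p)
    moreover have "2 * ((conn l q *v w) \<bullet> (G q *v w)) = w \<bullet> (DG l q *v w)" if "q \<in> S" for q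
      using metric_compatible[OF that, of w l w] inner_metric_sym[OF that] by simp
    ultimately have "has_dir_deriv (axis k 1) (\<lambda>q. w \<bullet> (DG l q *v w))
       (2 * ((conn l p *v w) \<bullet> (DG k p *v w) + (Dconn k l p *v w) \<bullet> (G p *v w))) p"
      using has_dir_deriv_cong_open[OF open_S p, of "\<lambda>q. 2 * ((conn l q *v w) \<bullet> (G q *v w))"] by simp
    from has_dir_deriv_unique[OF 1 this] show ?thesis
      by (simp add: metric_compatible[OF p])
  qed
  have "(curv_mat k l p *v w) \<bullet> (G p *v w) = 0"
    using second[of k l] second[of l k] Hsym[of k l]
      inner_metric_sym[OF p, of "conn l p *v w" "conn k p *v w"]
    by (simp add: curv_apply inner_diff_left inner_add_left)
  then show ?thesis by (metis inner_metric_sym[OF p])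
qed

end

section \<open>Parallel one-forms\<close>

locale chart_parallel_form = chart_metric A g c S
  for A :: "('m, 'n::finite) chart set" and g c S +
  fixes \<beta> :: "'m \<Rightarrow> ('m, 'n) tvec \<Rightarrow> real"
  assumes smooth_form: "smooth_on (form_comp A \<beta> c i) S"
    and parallel: "q \<in> S \<Longrightarrow>
        pd j (form_comp A \<beta> c i) q = (\<Sum>k\<in>UNIV. christoffel A g c k i j q * form_comp A \<beta> c k q)"
begin

definition form_vec :: "real^'n \<Rightarrow> real^'n" where
  "form_vec q = (\<chi> i. form_comp A \<beta> c i q)"

definition form_sq :: "real^'n \<Rightarrow> real" where
  "form_sq q = form_vec q \<bullet> (matrix_inv (G q) *v form_vec q)"

text \<open>\<open>\<nabla>\<beta> = 0\<close> as a differential equation for the row vector of components.\<close>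

lemma has_dir_deriv_form:
  assumes q: "q \<in> S" shows "has_dir_deriv (axis k 1) form_vec (form_vec q v* conn k q) q"
proof (intro has_dir_deriv_vecI)
  fix i
  have "has_dir_deriv (axis k 1) (form_comp A \<beta> c i) (pd k (form_comp A \<beta> c i) q) q"
    using smooth_on_has_dir_deriv[OF smooth_form q] pd_eqI by metis
  then show "has_dir_deriv (axis k 1) (\<lambda>q. form_vec q $ i) ((form_vec q v* conn k q) $ i) q"
    by (simp add: form_vec_def parallel[OF q] vector_matrix_mult_def conn_def christoffel_sym[OF q, of _ i k]
        mult.commute)
qed

lemma has_dir_deriv_form_apply:
  "q \<in> S \<Longrightarrow> has_dir_deriv (axis k 1) (\<lambda>q. form_vec q \<bullet> w) (form_vec q \<bullet> (conn k q *v w)) q"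
  using has_dir_deriv_inner[OF has_dir_deriv_form has_dir_deriv_const[of _ w], of q k] by (simp add: dot_lmul_matrix)

lemma form_vec_apply: "w \<bullet> form_vec q = (\<Sum>i\<in>UNIV. w $ i * form_comp A \<beta> c i q)"
  by (simp add: inner_vec_def form_vec_def)

text \<open>The Ricci identity for a parallel form. From \<open>\<partial>\<^sub>l \<beta>(w) = \<beta>(\<Gamma>\<^sub>l w)\<close> the second derivative is
\<open>\<beta>((\<partial>\<^sub>k \<Gamma>\<^sub>l) w + \<Gamma>\<^sub>k \<Gamma>\<^sub>l w)\<close>, and its antisymmetric part in \<open>k\<close> and \<open>l\<close> is \<open>\<beta>(R w)\<close>.\<close>

lemma form_curv:
  assumes p: "p \<in> S"
  shows "form_vec p \<bullet> (curv_mat k l p *v w) = 0"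
proof -
  define h where "h i k l = frechet_derivative
      (\<lambda>q. frechet_derivative (form_comp A \<beta> c i) (at q) (axis l 1)) (at p) (axis k 1)" for i k l
  have hsym: "h i k l = h i l k" for i k l
    unfolding h_def by (rule smooth_second_derivative_symmetric[OF smooth_form open_S p])
  have second: "(\<Sum>i\<in>UNIV. w $ i * h i k l) = form_vec p \<bullet> (Dconn k l p *v w)
      + form_vec p \<bullet> (conn k p *v (conn l p *v w))" for k l
  proof -
    let ?d = "\<lambda>i q. frechet_derivative (form_comp A \<beta> c i) (at q) (axis l 1)"
    have 1: "has_dir_deriv (axis k 1) (\<lambda>q. \<Sum>i\<in>UNIV. w $ i * ?d i q) (\<Sum>i\<in>UNIV. w $ i * h i k l) p"
      unfolding h_def by (intro has_dir_deriv_sum has_dir_deriv_linear[OF bounded_linear_mult_right]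
          smooth_on_has_dir_deriv[OF smooth_on_frechet[OF smooth_form] p])
    have "has_dir_deriv (axis k 1) (\<lambda>q. form_vec q \<bullet> (conn l q *v w))
        (form_vec p \<bullet> (conn l p *v 0 + Dconn k l p *v w) + (form_vec p v* conn k p) \<bullet> (conn l p *v w)) p"
      by (intro has_dir_deriv_inner has_dir_deriv_matrix_vector has_dir_deriv_const has_dir_deriv_conn has_dir_deriv_form p)
    moreover have "form_vec q \<bullet> (conn l q *v w) = (\<Sum>i\<in>UNIV. w $ i * ?d i q)" if "q \<in> S" for q
    proof (rule has_dir_deriv_unique[OF has_dir_deriv_form_apply[OF that]])
      show "has_dir_deriv (axis l 1) (\<lambda>q. form_vec q \<bullet> w) (\<Sum>i\<in>UNIV. w $ i * ?d i q) q"
        unfolding inner_commute[of _ w] form_vec_apply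
        by (intro has_dir_deriv_sum has_dir_deriv_linear[OF bounded_linear_mult_right]
          smooth_on_has_dir_deriv[OF smooth_form that])
    qed
    ultimately have "has_dir_deriv (axis k 1) (\<lambda>q. \<Sum>i\<in>UNIV. w $ i * ?d i q)
      (form_vec p \<bullet> (Dconn k l p *v w) + form_vec p \<bullet> (conn k p *v (conn l p *v w))) p"
      using has_dir_deriv_cong_open[OF open_S p, of "\<lambda>q. form_vec q \<bullet> (conn l q *v w)"]
      by (simp add: dot_lmul_matrix)
    from has_dir_deriv_unique[OF 1 this] show ?thesis .
  qed
  show ?thesis
    using second[of k l] second[of l k]
    by (simp add: hsym[of _ k l] curv_apply inner_diff_right inner_add_right)
qed

text \<open>The norm of a parallel form is constant. With \<open>X\<close> the vector dual to \<open>\<beta>\<close>, the number \<open>b\<^sup>2\<close> is both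
\<open>\<beta>(X)\<close> and \<open>g(X,X)\<close>. As \<open>\<nabla>g = 0\<close> and \<open>\<nabla>\<beta> = 0\<close>, its derivative is both \<open>\<beta>(\<nabla>X)\<close> and
\<open>2 g(X,\<nabla>X) = 2 \<beta>(\<nabla>X)\<close>, hence zero. Comparing the two expressions gives the derivative without a
formula for the derivative of the inverse matrix.\<close>

lemma has_dir_deriv_form_sq:
  assumes q: "q \<in> S"
  shows "has_dir_deriv (axis k 1) form_sq 0 q"
proof -
  obtain e where e: "has_dir_deriv (axis k 1) (\<lambda>q. matrix_inv (G q)) e q"
    using has_dir_deriv_metric_inv[OF q] by blast
  define X where "X q = matrix_inv (G q) *v form_vec q" for q
  obtain d where X: "has_dir_deriv (axis k 1) X d q"
    using has_dir_deriv_matrix_vector[OF e has_dir_deriv_form[OF q]] unfolding X_def by blast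
  have GX: "G q *v X q = form_vec q" if "q \<in> S" for q
    unfolding X_def using invertible_matrix_inv[OF metric_invertible[OF that]]
    by (simp add: matrix_vector_mul_assoc)
  have 1: "has_dir_deriv (axis k 1) form_sq (form_vec q \<bullet> d + (form_vec q v* conn k q) \<bullet> X q) q"
    using has_dir_deriv_inner[OF has_dir_deriv_form[OF q] X] by (simp add: X_def form_sq_def[abs_def])
  have "has_dir_deriv (axis k 1) (\<lambda>q. X q \<bullet> (G q *v X q))
      (X q \<bullet> (G q *v d + DG k q *v X q) + d \<bullet> (G q *v X q)) q"
    by (intro has_dir_deriv_inner has_dir_deriv_matrix_vector X has_dir_deriv_metric[OF q])
  then have 2: "has_dir_deriv (axis k 1) form_sq (X q \<bullet> (G q *v d + DG k q *v X q) + d \<bullet> (G q *v X q)) q"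
    using GX by (subst has_dir_deriv_cong_open[OF open_S q, of _ "\<lambda>q. X q \<bullet> (G q *v X q)"])
      (auto simp: form_sq_def X_def inner_commute)
  have a: "form_vec q \<bullet> d + (form_vec q v* conn k q) \<bullet> X q
      = X q \<bullet> (G q *v d + DG k q *v X q) + d \<bullet> (G q *v X q)"
    by (rule has_dir_deriv_unique[OF 1 2])
  have b: "X q \<bullet> (G q *v d) = d \<bullet> form_vec q"
    using inner_metric_sym[OF q, of "X q" d] GX[OF q] by simp
  have "X q \<bullet> (DG k q *v X q) = 2 * ((conn k q *v X q) \<bullet> form_vec q)"
    using metric_compatible[OF q, of "X q" k "X q"] inner_metric_sym[OF q, of "X q"] GX[OF q] by simp
  then have "form_vec q \<bullet> d + (form_vec q v* conn k q) \<bullet> X q = 2 * (form_vec q \<bullet> d + (form_vec q v* conn k q) \<bullet> X q)"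
    using a b GX[OF q] dot_lmul_matrix[of "form_vec q" "conn k q" "X q"]
    by (simp add: inner_right_distrib inner_commute[of d] inner_commute[of "conn k q *v X q"])
  moreover have "x = 2 * x \<Longrightarrow> x = 0" for x :: real by simp
  ultimately have z: "form_vec q \<bullet> d + (form_vec q v* conn k q) \<bullet> X q = 0" by blast
  show ?thesis using 1 unfolding z .
qed

end

section \<open>The Finsler function in a chart\<close>

locale chart_alpha_beta = chart_parallel_form A g c S \<beta>
  for A :: "('m, 'n::finite) chart set" and g c S \<beta> +
  fixes \<phi> :: "real \<Rightarrow> real \<Rightarrow> real" and U :: "(real \<times> real) set"
  assumes open_U: "open U"
    and smooth_phi: "smooth_on (\<lambda>(t, s). \<phi> t s) U"
    and arg_in_U: "q \<in> S \<Longrightarrow> w \<noteq> 0 \<Longrightarrow> (form_sq q, form_vec q \<bullet> w / sqrt (w \<bullet> (G q *v w))) \<in> U"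
begin

definition alpha_loc :: "real^'n \<Rightarrow> real^'n \<Rightarrow> real" where
  "alpha_loc q w = sqrt (w \<bullet> (G q *v w))"

definition s_loc :: "real^'n \<Rightarrow> real^'n \<Rightarrow> real" where
  "s_loc q w = form_vec q \<bullet> w / alpha_loc q w"

definition F_loc :: "real^'n \<Rightarrow> real^'n \<Rightarrow> real" where
  "F_loc q w = alpha_loc q w * \<phi> (form_sq q) (s_loc q w)"

text \<open>Three closed forms follow: the differential in \<open>w\<close> of \<open>F\<^sup>2\<close> at \<open>w\<close>, the differential of \<open>s\<close>, and half of the
  second differential of \<open>F\<^sup>2\<close>, which is the fundamental tensor.\<close>

definition dF_sq :: "real^'n \<Rightarrow> real^'n \<Rightarrow> real^'n \<Rightarrow> real" where
  "dF_sq q w v = 2 * (\<phi> (form_sq q) (s_loc q w) * (\<phi> (form_sq q) (s_loc q w) - s_loc q w * d2 \<phi> (form_sq q) (s_loc q w)) * (w \<bullet> (G q *v v))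
     + alpha_loc q w * \<phi> (form_sq q) (s_loc q w) * d2 \<phi> (form_sq q) (s_loc q w) * (form_vec q \<bullet> v))"

definition ds_loc :: "real^'n \<Rightarrow> real^'n \<Rightarrow> real^'n \<Rightarrow> real" where
  "ds_loc q w v = (form_vec q \<bullet> v - s_loc q w * (w \<bullet> (G q *v v)) / alpha_loc q w) / alpha_loc q w"

definition fund_form :: "real^'n \<Rightarrow> real^'n \<Rightarrow> real^'n \<Rightarrow> real^'n \<Rightarrow> real" where
  "fund_form q w u v = (let b2 = form_sq q; s = s_loc q w; \<phi>0 = \<phi> b2 s; \<phi>1 = d2 \<phi> b2 s; \<phi>2 = d2 (d2 \<phi>) b2 s in
     \<phi>0 * (\<phi>0 - s * \<phi>1) * (u \<bullet> (G q *v v))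
     + (\<phi>1 * (\<phi>0 - s * \<phi>1) - \<phi>0 * s * \<phi>2) * ds_loc q w u * (w \<bullet> (G q *v v))
     + (w \<bullet> (G q *v u)) / alpha_loc q w * \<phi>0 * \<phi>1 * (form_vec q \<bullet> v)
     + alpha_loc q w * (\<phi>1\<^sup>2 + \<phi>0 * \<phi>2) * ds_loc q w u * (form_vec q \<bullet> v))"

lemma alpha_loc_pos: "q \<in> S \<Longrightarrow> w \<noteq> 0 \<Longrightarrow> alpha_loc q w > 0"
  by (simp add: alpha_loc_def metric_pos)

lemma in_U: "q \<in> S \<Longrightarrow> w \<noteq> 0 \<Longrightarrow> (form_sq q, s_loc q w) \<in> U"
  using arg_in_U by (simp add: s_loc_def alpha_loc_def)

lemma phi_has_derivative:
  assumes "z \<in> U"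
  shows "((\<lambda>(t, s). \<phi> t s) has_derivative frechet_derivative (\<lambda>(t, s). \<phi> t s) (at z)) (at z)"
  using smooth_on_differentiable[OF smooth_phi assms] by (simp add: frechet_derivative_works)

text \<open>The partial derivatives \<open>d2\<close> are taken at fixed \<open>t\<close>, while smoothness is a statement about the function of two
variables on \<open>U\<close>.\<close>

lemma d2_eq_frechet:
  assumes "(t, s) \<in> U"
  shows "((\<phi> t) has_real_derivative frechet_derivative (\<lambda>(t, s). \<phi> t s) (at (t, s)) (0, 1)) (at s)"
    and "d2 \<phi> t s = frechet_derivative (\<lambda>(t, s). \<phi> t s) (at (t, s)) (0, 1)"
proof -
  show *: "((\<phi> t) has_real_derivative frechet_derivative (\<lambda>(t, s). \<phi> t s) (at (t, s)) (0, 1)) (at s)"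
    using has_dir_deriv_shift[of "(0, 1)" "\<lambda>(t, s). \<phi> t s" _ "(t, 0)" s]
      smooth_on_has_dir_deriv[OF smooth_phi assms, of "(0, 1)"] by simp
  show "d2 \<phi> t s = frechet_derivative (\<lambda>(t, s). \<phi> t s) (at (t, s)) (0, 1)"
    unfolding d2_def using * by (rule DERIV_imp_deriv)
qed

lemma phi_deriv: "(t, s) \<in> U \<Longrightarrow> ((\<phi> t) has_real_derivative d2 \<phi> t s) (at s)"
  using d2_eq_frechet by metis

lemma d2_phi_deriv:
  assumes "(t, s) \<in> U"
  shows "((d2 \<phi> t) has_real_derivative d2 (d2 \<phi>) t s) (at s)"
proof -
  let ?f = "\<lambda>z. frechet_derivative (\<lambda>(t, s). \<phi> t s) (at z) (0, 1)"
  have "smooth_on ?f U" by (rule smooth_on_frechet[OF smooth_phi])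
  then have "has_dir_deriv (0, 1) ?f (frechet_derivative ?f (at (t, s)) (0, 1)) (t, s)"
    by (rule smooth_on_has_dir_deriv[OF _ assms])
  then have 1: "((\<lambda>s. ?f (t, s)) has_real_derivative (frechet_derivative ?f (at (t, s)) (0, 1))) (at s)"
    using has_dir_deriv_shift[of "(0, 1)" ?f _ "(t, 0)" s] by simp
  have "eventually (\<lambda>s. (t, s) \<in> U) (nhds s)"
  proof -
    have "((\<lambda>s. (t, s)) \<longlongrightarrow> (t, s)) (nhds s)" by (intro tendsto_intros filterlim_ident)
    then show ?thesis using open_U assms topological_tendstoD by blast
  qed
  then have "eventually (\<lambda>s. d2 \<phi> t s = ?f (t, s)) (nhds s)"
    by (rule eventually_mono) (rule d2_eq_frechet)
  then have "((d2 \<phi> t) has_real_derivative (frechet_derivative ?f (at (t, s)) (0, 1))) (at s) \<longleftrightarrow>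
     ((\<lambda>s. ?f (t, s)) has_real_derivative (frechet_derivative ?f (at (t, s)) (0, 1))) (at s)"
    by (intro DERIV_cong_ev) auto
  with 1 have "((d2 \<phi> t) has_real_derivative (frechet_derivative ?f (at (t, s)) (0, 1))) (at s)" by blast
  then show ?thesis unfolding d2_def[of "d2 \<phi>"] using DERIV_imp_deriv by metis
qed

lemma dF_sq_linear: "linear (dF_sq q w)"
  by (rule linearI) (simp_all add: dF_sq_def algebra_simps inner_add_right)

lemma fund_form_linear_right: "linear (fund_form q w u)"
  by (rule linearI) (simp_all add: fund_form_def Let_def algebra_simps inner_add_right add_divide_distrib)

lemma ds_loc_linear: "linear (ds_loc q w)"
  by (rule linearI) (simp_all add: ds_loc_def algebra_simps inner_add_right add_divide_distrib diff_divide_distrib)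

lemma fund_form_linear_left: "linear (\<lambda>u. fund_form q w u v)"
  by (rule linearI) (simp_all add: fund_form_def Let_def linear_add[OF ds_loc_linear] linear_scale[OF ds_loc_linear]
     algebra_simps inner_add_right inner_add_left add_divide_distrib)

lemma has_dir_deriv_alpha_loc:
  assumes q: "q \<in> S" and w: "w \<noteq> 0"
  shows "has_dir_deriv v (alpha_loc q) ((w \<bullet> (G q *v v)) / alpha_loc q w) w"
proof -
  have "has_dir_deriv v (\<lambda>w. w \<bullet> (G q *v w)) (w \<bullet> (G q *v v + 0 *v w) + v \<bullet> (G q *v w)) w"
    by (intro has_dir_deriv_inner has_dir_deriv_matrix_vector has_dir_deriv_const has_dir_deriv_id)
  then have "((\<lambda>t. (w + t *\<^sub>R v) \<bullet> (G q *v (w + t *\<^sub>R v))) has_real_derivative 2 * (w \<bullet> (G q *v v))) (at 0)"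
    using inner_metric_sym[OF q, of v w] unfolding has_dir_deriv_real by simp
  then show ?thesis
    unfolding has_dir_deriv_real alpha_loc_def[abs_def] using metric_pos[OF q w]
    by (auto intro!: derivative_eq_intros simp: field_simps)
qed

lemma has_dir_deriv_s_loc:
  assumes q: "q \<in> S" and w: "w \<noteq> 0"
  shows "has_dir_deriv v (s_loc q) (ds_loc q w v) w"
proof -
  have "has_dir_deriv v (\<lambda>w. form_vec q \<bullet> w) (form_vec q \<bullet> v + 0 \<bullet> w) w"
    by (intro has_dir_deriv_inner has_dir_deriv_const has_dir_deriv_id)
  then show ?thesis
    using has_dir_deriv_alpha_loc[OF q w, of v] alpha_loc_pos[OF q w] unfolding has_dir_deriv_real s_loc_def[abs_def]
    by (auto intro!: derivative_eq_intros simp: ds_loc_def s_loc_def field_simps)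
qed

lemma has_dir_deriv_F_squared:
  assumes q: "q \<in> S" and w: "w \<noteq> 0"
  shows "has_dir_deriv v (\<lambda>w. (F_loc q w)\<^sup>2) (dF_sq q w v) w"
proof -
  note 1 = has_dir_deriv_alpha_loc[OF q w, of v]
  note 2 = has_dir_deriv_compose_real[OF has_dir_deriv_s_loc[OF q w, of v] phi_deriv[OF in_U[OF q w]]]
  show ?thesis
    using 1 2 alpha_loc_pos[OF q w] unfolding has_dir_deriv_real F_loc_def
    by (auto intro!: derivative_eq_intros simp: dF_sq_def ds_loc_def field_simps power2_eq_square)
qed

text \<open>The second argument may vary with \<open>w\<close>, since the mixed derivatives in the spray differentiate
\<open>dF_sq q w (conn k q *v w)\<close>.\<close>

lemma has_dir_deriv_dF_sq:
  assumes q: "q \<in> S" and w: "w \<noteq> 0" and z: "has_dir_deriv u z dz w"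
  shows "has_dir_deriv u (\<lambda>w. dF_sq q w (z w)) (2 * fund_form q w u (z w) + dF_sq q w dz) w"
proof -
  note 1 = has_dir_deriv_alpha_loc[OF q w, of u]
  note 2 = has_dir_deriv_compose_real[OF has_dir_deriv_s_loc[OF q w, of u] phi_deriv[OF in_U[OF q w]]]
  note 3 = has_dir_deriv_compose_real[OF has_dir_deriv_s_loc[OF q w, of u] d2_phi_deriv[OF in_U[OF q w]]]
  note 4 = has_dir_deriv_s_loc[OF q w, of u]
  have 5: "has_dir_deriv u (\<lambda>w. w \<bullet> (G q *v z w)) (w \<bullet> (G q *v dz + 0 *v z w) + u \<bullet> (G q *v z w)) w"
    by (intro has_dir_deriv_inner has_dir_deriv_matrix_vector has_dir_deriv_const has_dir_deriv_id z)
  have 6: "has_dir_deriv u (\<lambda>w. form_vec q \<bullet> z w) (form_vec q \<bullet> dz + 0 \<bullet> z w) w"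
    by (intro has_dir_deriv_inner has_dir_deriv_const z)
  from has_dir_deriv_linear[OF bounded_linear_mult_right[of 2] has_dir_deriv_add[OF
      has_dir_deriv_mult[OF has_dir_deriv_mult[OF 2 has_dir_deriv_diff[OF 2 has_dir_deriv_mult[OF 4 3]]] 5]
      has_dir_deriv_mult[OF has_dir_deriv_mult[OF has_dir_deriv_mult[OF 1 2] 3] 6]]]
  show ?thesis
    unfolding dF_sq_def by (rule has_dir_deriv_eq_rhs) (simp add: fund_form_def Let_def algebra_simps power2_eq_square)
qed

text \<open>The reason for the whole result: along the base, \<open>F\<^sup>2\<close> varies as if only the vector moved, with velocity
\<open>\<Gamma>\<^sub>k w\<close>. The functions \<open>g(w,w)\<close> and \<open>\<beta>(w)\<close> have this property because \<open>g\<close> and \<open>\<beta>\<close> are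
parallel, and the remaining argument \<open>b\<^sup>2\<close> of \<open>\<phi>\<close> is constant.\<close>

lemma has_dir_deriv_F_squared_base:
  assumes q: "q \<in> S" and w: "w \<noteq> 0"
  shows "has_dir_deriv (axis k 1) (\<lambda>q. (F_loc q w)\<^sup>2) (dF_sq q w (conn k q *v w)) q"
proof -
  let ?v = "conn k q *v w"
  have "has_dir_deriv (axis k 1) (\<lambda>q. w \<bullet> (G q *v w)) (w \<bullet> (G q *v 0 + DG k q *v w) + 0 \<bullet> (G q *v w)) q"
    by (intro has_dir_deriv_inner has_dir_deriv_matrix_vector has_dir_deriv_const has_dir_deriv_metric q)
  then have "((\<lambda>t. w \<bullet> (G (q + t *\<^sub>R axis k 1) *v w)) has_real_derivative 2 * (w \<bullet> (G q *v ?v))) (at 0)"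
    using inner_metric_sym[OF q, of w ?v] unfolding has_dir_deriv_real by (simp add: metric_compatible[OF q])
  then have 1: "has_dir_deriv (axis k 1) (\<lambda>q. alpha_loc q w) ((w \<bullet> (G q *v ?v)) / alpha_loc q w) q"
    unfolding has_dir_deriv_real alpha_loc_def using metric_pos[OF q w]
    by (auto intro!: derivative_eq_intros simp: field_simps)
  have 2: "has_dir_deriv (axis k 1) (\<lambda>q. s_loc q w) (ds_loc q w ?v) q"
    using has_dir_deriv_form_apply[OF q, of k w] 1 alpha_loc_pos[OF q w] unfolding has_dir_deriv_real s_loc_def
    by (auto intro!: derivative_eq_intros simp: ds_loc_def s_loc_def field_simps)
  \<comment> \<open>the first component has derivative zero, so only the partial derivative of \<open>\<phi>\<close> in \<open>s\<close> contributes\<close>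
  have "((\<lambda>t. (form_sq (q + t *\<^sub>R axis k 1), s_loc (q + t *\<^sub>R axis k 1) w)) has_vector_derivative (0, ds_loc q w ?v)) (at 0)"
    using has_dir_deriv_form_sq[OF q, of k] 2 unfolding has_dir_deriv_def by (intro has_vector_derivative_Pair) auto
  then have "((\<lambda>t. \<phi> (form_sq (q + t *\<^sub>R axis k 1)) (s_loc (q + t *\<^sub>R axis k 1) w)) has_derivative
     (\<lambda>h. frechet_derivative (\<lambda>(t, s). \<phi> t s) (at (form_sq q, s_loc q w)) (h *\<^sub>R (0, ds_loc q w ?v)))) (at 0)"
    unfolding has_vector_derivative_def
    by (drule_tac has_derivative_compose[where g="\<lambda>(t, s). \<phi> t s"])
       (use phi_has_derivative[OF in_U[OF q w]] in auto)
  moreover have "frechet_derivative (\<lambda>(t, s). \<phi> t s) (at (form_sq q, s_loc q w)) (h *\<^sub>R (0, ds_loc q w ?v))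
      = h *\<^sub>R (ds_loc q w ?v * d2 \<phi> (form_sq q) (s_loc q w))" for h
    using linear_scale[OF has_derivative_linear[OF phi_has_derivative[OF in_U[OF q w]]], of "h * ds_loc q w ?v" "(0, 1)"]
    by (simp add: d2_eq_frechet(2)[OF in_U[OF q w]])
  ultimately have 3: "has_dir_deriv (axis k 1) (\<lambda>q. \<phi> (form_sq q) (s_loc q w)) (ds_loc q w ?v * d2 \<phi> (form_sq q) (s_loc q w)) q"
    by (simp add: has_dir_deriv_def has_vector_derivative_def)
  show ?thesis
    using 1 3 alpha_loc_pos[OF q w] unfolding has_dir_deriv_real F_loc_def
    by (auto intro!: derivative_eq_intros simp: dF_sq_def ds_loc_def field_simps power2_eq_square)
qed

lemma second_deriv_F_squared:
  assumes q: "q \<in> S" and w: "w \<noteq> 0"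
  shows "deriv (\<lambda>s. deriv (\<lambda>t. (F_loc q (w + (s *\<^sub>R u + t *\<^sub>R v)))\<^sup>2) 0) 0 = 2 * fund_form q w u v"
proof -
  have inner: "deriv (\<lambda>t. (F_loc q (z + t *\<^sub>R v))\<^sup>2) 0 = dF_sq q z v" if "z \<noteq> 0" for z
    using has_dir_deriv_F_squared[OF q that, of v] unfolding has_dir_deriv_real by (rule DERIV_imp_deriv)
  have "eventually (\<lambda>s. w + s *\<^sub>R u \<in> - {0}) (nhds 0)"
    using w by (intro eventually_line_in_open) auto
  then have "eventually (\<lambda>s. deriv (\<lambda>t. (F_loc q (w + (s *\<^sub>R u + t *\<^sub>R v)))\<^sup>2) 0 = dF_sq q (w + s *\<^sub>R u) v) (nhds 0)"
    by (rule eventually_mono) (simp add: inner add.assoc[symmetric])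
  then have "deriv (\<lambda>s. deriv (\<lambda>t. (F_loc q (w + (s *\<^sub>R u + t *\<^sub>R v)))\<^sup>2) 0) 0 = deriv (\<lambda>s. dF_sq q (w + s *\<^sub>R u) v) 0"
    by (intro deriv_cong_ev) auto
  also have "\<dots> = 2 * fund_form q w u v"
    using has_dir_deriv_dF_sq[OF q w has_dir_deriv_const, of u v] unfolding has_dir_deriv_real
    by (intro DERIV_imp_deriv) (simp add: linear_0[OF dF_sq_linear])
  finally show ?thesis .
qed

end

section \<open>Spray and curvature\<close>

lemma open_nonzero: "open (- {0 :: real^'n})"
  by (simp add: open_Compl)

lemma linear_eq_sum_axis:
  fixes f :: "real^'n \<Rightarrow> real"
  assumes "linear f" shows "f v = (\<Sum>i\<in>UNIV. v $ i * f (axis i 1))"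
proof -
  have "f v = f (\<Sum>i\<in>UNIV. (v $ i) *\<^sub>R axis i 1)"
    using basis_expansion[of v] by (simp add: scalar_mult_eq_scaleR)
  also have "\<dots> = (\<Sum>i\<in>UNIV. v $ i * f (axis i 1))"
    by (simp add: linear_sum[OF assms] linear_scale[OF assms])
  finally show ?thesis .
qed

lemma has_dir_deriv_quadratic_form:
  fixes B :: "real^'n^'n"
  assumes "transpose B = B"
  shows "has_dir_deriv u (\<lambda>v. (v \<bullet> (B *v v)) / 2) (u \<bullet> (B *v w)) w"
proof -
  have sym: "w \<bullet> (B *v u) = u \<bullet> (B *v w)"
    by (metis assms dot_lmul_matrix inner_commute vector_transpose_matrix)
  have "has_dir_deriv u (\<lambda>v. inverse 2 * (v \<bullet> (B *v v))) (inverse 2 * (w \<bullet> (B *v u + 0 *v w) + u \<bullet> (B *v w))) w"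
    by (intro has_dir_deriv_linear[OF bounded_linear_mult_right] has_dir_deriv_inner has_dir_deriv_matrix_vector
       has_dir_deriv_const has_dir_deriv_id)
  then show ?thesis by (simp add: sym field_simps)
qed

text \<open>The assumptions say how \<open>F\<close> and its fundamental tensor look in the chart; they are discharged below for a metric on
the manifold.\<close>

locale chart_spray = chart_alpha_beta A g c S \<beta> \<phi> U
  for A :: "('m, 'n::finite) chart set" and g c S \<beta> \<phi> U +
  fixes F :: "'m \<Rightarrow> ('m, 'n) tvec \<Rightarrow> real"
  assumes local_rep_eq: "q \<in> S \<Longrightarrow> w \<noteq> 0 \<Longrightarrow> local_rep A F c q w = F_loc q w"
    and fundamental_mat_eq: "q \<in> S \<Longrightarrow> w \<noteq> 0 \<Longrightarrow>
      fundamental_mat A F c q w $ l $ m = fund_form q w (axis l 1) (axis m 1)"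
    and fund_form_pos: "q \<in> S \<Longrightarrow> w \<noteq> 0 \<Longrightarrow> v \<noteq> 0 \<Longrightarrow> fund_form q w v v > 0"
    and phi_pos: "q \<in> S \<Longrightarrow> w \<noteq> 0 \<Longrightarrow> \<phi> (form_sq q) (s_loc q w) > 0"
begin

lemma fundamental_mat_apply:
  assumes "q \<in> S" "w \<noteq> 0"
  shows "(fundamental_mat A F c q w *v v) $ l = fund_form q w (axis l 1) v"
  by (subst linear_eq_sum_axis[OF fund_form_linear_right])
     (simp add: matrix_vector_mult_def fundamental_mat_eq[OF assms] mult.commute)

lemma fundamental_mat_invertible:
  assumes "q \<in> S" "w \<noteq> 0"
  shows "invertible (fundamental_mat A F c q w)"
  unfolding invertible_left_inverse matrix_left_invertible_ker
proof (intro allI impI)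
  fix v assume "fundamental_mat A F c q w *v v = 0"
  then have "fund_form q w (axis l 1) v = 0" for l
    using fundamental_mat_apply[OF assms, of v l] by simp
  then have "fund_form q w v v = 0"
    using linear_eq_sum_axis[OF fund_form_linear_left, of q w v v] by simp
  then show "v = 0" using fund_form_pos[OF assms] by fastforce
qed

text \<open>Write \<open>L = F\<^sup>2\<close> and \<open>L' = dF_sq\<close>. By \<open>\<partial>\<^sub>k L = L'(\<Gamma>\<^sub>k w)\<close>, the derivative along the fibre of
\<open>\<partial>\<^sub>k L\<close> in direction \<open>l\<close> is \<open>2 g\<^sup>F(e\<^sub>l, \<Gamma>\<^sub>k w) + L'(\<Gamma>\<^sub>k e\<^sub>l)\<close>. Contracted with \<open>w\<^sup>k\<close>, the last term becomes
\<open>L'(\<Gamma>\<^sub>l w)\<close> by the symmetry of the Christoffel symbols and cancels against \<open>\<partial>\<^sub>l L\<close>. What is left is the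
lowered vector \<open>\<Gamma>(w,w)\<close>, which the inverse of the fundamental matrix raises again.\<close>

lemma spray_eq_conn:
  assumes q: "q \<in> S" and w: "w \<noteq> 0"
  shows "spray A F c i q w = (\<Sum>k\<in>UNIV. w $ k * (conn k q *v w) $ i) / 2"
proof -
  define L where "L q v = (local_rep A F c q v)\<^sup>2" for q v
  define N where "N = (\<Sum>k\<in>UNIV. w $ k *\<^sub>R (conn k q *v w))"
  have horizontal: "pd k (\<lambda>q. L q v) q = dF_sq q v (conn k q *v v)" if "v \<noteq> 0" for k v
  proof -
    have "pd k (\<lambda>q. L q v) q = pd k (\<lambda>q. (F_loc q v)\<^sup>2) q"
      using that by (intro pd_cong_open[OF open_S q]) (simp add: L_def local_rep_eq)
    then show ?thesis using pd_eqI[OF has_dir_deriv_F_squared_base[OF q that]] by simp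
  qed
  have mixed: "pd l (\<lambda>v. pd k (\<lambda>q. L q v) q) w
      = 2 * fund_form q w (axis l 1) (conn k q *v w) + dF_sq q w (conn k q *v axis l 1)" for k l
  proof -
    have "pd l (\<lambda>v. pd k (\<lambda>q. L q v) q) w = pd l (\<lambda>v. dF_sq q v (conn k q *v v)) w"
      using w by (intro pd_cong_open[OF open_nonzero]) (auto simp: horizontal)
    also have "\<dots> = 2 * fund_form q w (axis l 1) (conn k q *v w) + dF_sq q w (conn k q *v axis l 1 + 0 *v w)"
      by (intro pd_eqI has_dir_deriv_dF_sq[OF q w] has_dir_deriv_matrix_vector has_dir_deriv_const has_dir_deriv_id)
    finally show ?thesis by simp
  qed
  have lowered: "(\<Sum>k\<in>UNIV. pd l (\<lambda>v. pd k (\<lambda>q. L q v) q) w * (w $ k)) - pd l (\<lambda>q. L q w) q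
      = 2 * fund_form q w (axis l 1) N" for l
  proof -
    have "(\<Sum>k\<in>UNIV. w $ k *\<^sub>R (conn k q *v axis l 1)) = conn l q *v w"
    proof -
      have "(conn k q *v axis l 1) $ i = \<Gamma> i l k q" for k i
        by (simp add: matrix_vector_mult_basis column_def conn_def christoffel_sym[OF q, of i k])
      moreover have "(conn l q *v w) $ i = (\<Sum>k\<in>UNIV. w $ k * \<Gamma> i l k q)" for i
        by (simp add: matrix_vector_mult_def conn_def mult.commute)
      ultimately show ?thesis by (simp add: vec_eq_iff)
    qed
    then have "dF_sq q w (conn l q *v w) = (\<Sum>k\<in>UNIV. w $ k * dF_sq q w (conn k q *v axis l 1))"
      using linear_sum[OF dF_sq_linear, of q w "\<lambda>k. w $ k *\<^sub>R (conn k q *v axis l 1)" UNIV]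
      by (simp add: linear_scale[OF dF_sq_linear])
    moreover have "fund_form q w (axis l 1) N = (\<Sum>k\<in>UNIV. w $ k * fund_form q w (axis l 1) (conn k q *v w))"
      unfolding N_def by (simp add: linear_sum[OF fund_form_linear_right] linear_scale[OF fund_form_linear_right])
    ultimately show ?thesis
      by (simp add: mixed horizontal[OF w] algebra_simps sum.distrib sum_distrib_left)
  qed
  let ?B = "fundamental_mat A F c q w"
  have "spray A F c i q w = (\<Sum>l\<in>UNIV. matrix_inv ?B $ i $ l *
         ((\<Sum>k\<in>UNIV. pd l (\<lambda>v. pd k (\<lambda>q. L q v) q) w * (w $ k)) - pd l (\<lambda>q. L q w) q)) / 4"
    by (simp add: spray_def L_def)
  also have "\<dots> = (\<Sum>l\<in>UNIV. matrix_inv ?B $ i $ l * (?B *v N) $ l) / 2"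
    by (simp add: lowered fundamental_mat_apply[OF q w] sum_divide_distrib)
  also have "(\<Sum>l\<in>UNIV. matrix_inv ?B $ i $ l * (?B *v N) $ l) = (matrix_inv ?B *v (?B *v N)) $ i"
    by (simp add: matrix_vector_mult_def)
  also have "matrix_inv ?B *v (?B *v N) = N"
    by (simp add: matrix_vector_mul_assoc invertible_matrix_inv[OF fundamental_mat_invertible[OF q w]])
  finally show ?thesis by (simp add: N_def)
qed

text \<open>The symmetric matrix of the quadratic form \<open>\<Gamma>\<^sup>i(w,w)\<close>; here the upper index is fixed, in \<open>conn\<close> one of the lower ones.\<close>

definition christoffel_mat :: "'n \<Rightarrow> real^'n \<Rightarrow> real^'n^'n" where
  "christoffel_mat i q = (\<chi> a b. \<Gamma> i a b q)"

definition Dchristoffel_mat :: "'n \<Rightarrow> 'n \<Rightarrow> real^'n \<Rightarrow> real^'n^'n" where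
  "Dchristoffel_mat j i q = (\<chi> a b. pd j (\<Gamma> i a b) q)"

lemma christoffel_mat_sym: "q \<in> S \<Longrightarrow> transpose (christoffel_mat i q) = christoffel_mat i q"
  by (simp add: transpose_def christoffel_mat_def vec_eq_iff christoffel_sym)

lemma Dchristoffel_mat_sym: "q \<in> S \<Longrightarrow> transpose (Dchristoffel_mat j i q) = Dchristoffel_mat j i q"
  using pd_cong_open[OF open_S, of q "\<Gamma> i a b" "\<Gamma> i b a" j for a b]
  by (simp add: transpose_def Dchristoffel_mat_def vec_eq_iff christoffel_sym)

lemma has_dir_deriv_christoffel_mat: "q \<in> S \<Longrightarrow> has_dir_deriv (axis j 1) (christoffel_mat i) (Dchristoffel_mat j i q) q"
  by (intro has_dir_deriv_vecI) (simp add: christoffel_mat_def Dchristoffel_mat_def has_dir_deriv_christoffel)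

lemma spray_eq:
  assumes q: "q \<in> S" and w: "w \<noteq> 0"
  shows "spray A F c i q w = (w \<bullet> (christoffel_mat i q *v w)) / 2"
  by (simp add: spray_eq_conn[OF assms] inner_vec_def christoffel_mat_def conn_def matrix_vector_mult_def)

lemma pd_spray_position:
  assumes q: "q \<in> S" and w: "w \<noteq> 0"
  shows "pd j (\<lambda>q. spray A F c i q w) q = (w \<bullet> (Dchristoffel_mat j i q *v w)) / 2"
proof -
  have "has_dir_deriv (axis j 1) (\<lambda>q. inverse 2 * (w \<bullet> (christoffel_mat i q *v w)))
     (inverse 2 * (w \<bullet> (christoffel_mat i q *v 0 + Dchristoffel_mat j i q *v w) + 0 \<bullet> (christoffel_mat i q *v w))) q"
    by (intro has_dir_deriv_linear[OF bounded_linear_mult_right] has_dir_deriv_inner has_dir_deriv_matrix_vector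
       has_dir_deriv_const has_dir_deriv_christoffel_mat q)
  then have "pd j (\<lambda>q. (w \<bullet> (christoffel_mat i q *v w)) / 2) q = (w \<bullet> (Dchristoffel_mat j i q *v w)) / 2"
    by (intro pd_eqI) (simp add: field_simps)
  then show ?thesis
    using pd_cong_open[OF open_S q, of "\<lambda>q. spray A F c i q w" "\<lambda>q. (w \<bullet> (christoffel_mat i q *v w)) / 2"]
    by (simp add: spray_eq w)
qed

lemma pd_spray_direction:
  assumes q: "q \<in> S" and w: "w \<noteq> 0"
  shows "pd j (spray A F c i q) w = axis j 1 \<bullet> (christoffel_mat i q *v w)"
  using pd_cong_open[OF open_nonzero, of w "spray A F c i q" "\<lambda>w. (w \<bullet> (christoffel_mat i q *v w)) / 2" j]
    pd_eqI[OF has_dir_deriv_quadratic_form[OF christoffel_mat_sym[OF q, of i], of "axis j 1" w]]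
  by (simp add: spray_eq q w)

lemma pd_spray_direction_position:
  assumes q: "q \<in> S" and w: "w \<noteq> 0"
  shows "pd k (\<lambda>v. pd j (\<lambda>q. spray A F c i q v) q) w = axis k 1 \<bullet> (Dchristoffel_mat j i q *v w)"
  using pd_cong_open[OF open_nonzero, of w "\<lambda>v. pd j (\<lambda>q. spray A F c i q v) q" "\<lambda>w. (w \<bullet> (Dchristoffel_mat j i q *v w)) / 2" k]
    pd_eqI[OF has_dir_deriv_quadratic_form[OF Dchristoffel_mat_sym[OF q, of j i], of "axis k 1" w]]
  by (simp add: pd_spray_position q w)

lemma pd_spray_direction_twice:
  assumes q: "q \<in> S" and w: "w \<noteq> 0"
  shows "pd k (\<lambda>v. pd j (spray A F c i q) v) w = axis j 1 \<bullet> (christoffel_mat i q *v axis k 1)"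
proof -
  have "pd k (\<lambda>v. pd j (spray A F c i q) v) w = pd k (\<lambda>w. axis j 1 \<bullet> (christoffel_mat i q *v w)) w"
    using w by (intro pd_cong_open[OF open_nonzero]) (auto simp: pd_spray_direction q)
  also have "\<dots> = axis j 1 \<bullet> (christoffel_mat i q *v axis k 1 + 0 *v w) + 0 \<bullet> (christoffel_mat i q *v w)"
    by (intro pd_eqI has_dir_deriv_inner has_dir_deriv_matrix_vector has_dir_deriv_const has_dir_deriv_id)
  finally show ?thesis by simp
qed

text \<open>For a spray that is quadratic in \<open>w\<close>, the four terms of the Finsler curvature are the four terms of the
Riemann curvature tensor contracted twice with \<open>w\<close>.\<close>

lemma finsler_curv_comp_eq:
  assumes q: "q \<in> S" and w: "w \<noteq> 0"
  shows "finsler_curv_comp A F c i k q w = (\<Sum>b\<in>UNIV. w $ b * (curv_mat k b q *v w) $ i)"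
proof -
  have a: "(\<Sum>b\<in>UNIV. w $ b * (Dconn k b q *v w) $ i) = w \<bullet> (Dchristoffel_mat k i q *v w)"
    by (simp add: inner_vec_def Dconn_def Dchristoffel_mat_def matrix_vector_mult_def)
  have b: "(\<Sum>b\<in>UNIV. w $ b * (Dconn b k q *v w) $ i)
      = (\<Sum>b\<in>UNIV. w $ b * (axis k 1 \<bullet> (Dchristoffel_mat b i q *v w)))"
    by (simp add: inner_axis' Dconn_def Dchristoffel_mat_def matrix_vector_mult_def)
  have "(\<Sum>b\<in>UNIV. w $ b * (conn k q *v (conn b q *v w)) $ i)
      = (\<Sum>b\<in>UNIV. \<Sum>m\<in>UNIV. \<Gamma> i m k q * (w $ b * (conn b q *v w) $ m))"
    unfolding matrix_vector_mult_def[of "conn k q"]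
    by (simp add: conn_def[of k] sum_distrib_left christoffel_sym[OF q, of i k] mult.left_commute)
  also have "\<dots> = (\<Sum>m\<in>UNIV. \<Gamma> i m k q * (w \<bullet> (christoffel_mat m q *v w)))"
    by (subst sum.swap) (simp add: sum_distrib_left[symmetric] inner_vec_def conn_def christoffel_mat_def matrix_vector_mult_def)
  finally have c: "(\<Sum>b\<in>UNIV. w $ b * (conn k q *v (conn b q *v w)) $ i)
      = (\<Sum>m\<in>UNIV. \<Gamma> i m k q * (w \<bullet> (christoffel_mat m q *v w)))" .
  have "(\<Sum>b\<in>UNIV. w $ b * (conn b q *v (conn k q *v w)) $ i)
      = (\<Sum>b\<in>UNIV. \<Sum>m\<in>UNIV. (\<Gamma> i m b q * w $ b) * (conn k q *v w) $ m)"
  proof -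
    have "(conn b q *v z) $ i = (\<Sum>m\<in>UNIV. \<Gamma> i m b q * z $ m)" for b z
      by (simp add: matrix_vector_mult_def conn_def christoffel_sym[OF q, of i b])
    from this[of _ "conn k q *v w"] show ?thesis by (simp add: sum_distrib_left mult_ac)
  qed
  also have "\<dots> = (\<Sum>m\<in>UNIV. (axis m 1 \<bullet> (christoffel_mat i q *v w)) * (axis k 1 \<bullet> (christoffel_mat m q *v w)))"
    by (subst sum.swap) (simp add: sum_distrib_right[symmetric] inner_axis' conn_def christoffel_mat_def matrix_vector_mult_def)
  finally have d: "(\<Sum>b\<in>UNIV. w $ b * (conn b q *v (conn k q *v w)) $ i)
      = (\<Sum>m\<in>UNIV. (axis m 1 \<bullet> (christoffel_mat i q *v w)) * (axis k 1 \<bullet> (christoffel_mat m q *v w)))" .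
  have "finsler_curv_comp A F c i k q w = w \<bullet> (Dchristoffel_mat k i q *v w)
      - (\<Sum>b\<in>UNIV. w $ b * (axis k 1 \<bullet> (Dchristoffel_mat b i q *v w)))
      + (\<Sum>m\<in>UNIV. \<Gamma> i m k q * (w \<bullet> (christoffel_mat m q *v w)))
      - (\<Sum>m\<in>UNIV. (axis m 1 \<bullet> (christoffel_mat i q *v w)) * (axis k 1 \<bullet> (christoffel_mat m q *v w)))"
    by (simp add: finsler_curv_comp_def Let_def pd_spray_position[OF assms] pd_spray_direction[OF assms]
       pd_spray_direction_position[OF assms] pd_spray_direction_twice[OF assms] spray_eq[OF assms]
       sum_distrib_left inner_axis' matrix_vector_mult_basis column_def christoffel_mat_def mult.commute)
  also have "\<dots> = (\<Sum>b\<in>UNIV. w $ b * (curv_mat k b q *v w) $ i)"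
    unfolding a[symmetric] b[symmetric] c[symmetric] d[symmetric]
    by (simp add: curv_apply algebra_simps sum.distrib sum_subtractf)
  finally show ?thesis .
qed

end

section \<open>Algebra of the curvature\<close>

context chart_metric begin

text \<open>\<open>R(u,v)w\<close>, for the curvature tensor at the point with coordinates \<open>q\<close>.\<close>

definition curv_vec :: "real^'n \<Rightarrow> real^'n \<Rightarrow> real^'n \<Rightarrow> real^'n \<Rightarrow> real^'n" where
  "curv_vec q u v w = (\<Sum>k\<in>UNIV. \<Sum>l\<in>UNIV. (u $ k * v $ l) *\<^sub>R (curv_mat k l q *v w))"

lemma curv_vec_swap: "curv_vec q v u w = - curv_vec q u v w"
proof -
  have neg: "curv_mat k l q *v w = - (curv_mat l k q *v w)" for k l
    by (simp add: curv_apply)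
  have "curv_vec q v u w = (\<Sum>k\<in>UNIV. \<Sum>l\<in>UNIV. - ((u $ l * v $ k) *\<^sub>R (curv_mat l k q *v w)))"
    unfolding curv_vec_def by (intro sum.cong refl, subst neg) (simp add: mult.commute)
  also have "\<dots> = - curv_vec q u v w"
    unfolding curv_vec_def by (subst sum.swap) (simp add: sum_negf)
  finally show ?thesis .
qed

lemma curv_vec_add: "curv_vec q u v (w + z) = curv_vec q u v w + curv_vec q u v z"
  by (simp add: curv_vec_def matrix_vector_right_distrib scaleR_add_right sum.distrib)

lemma curv_vec_skew_diag:
  assumes q: "q \<in> S" shows "w \<bullet> (G q *v curv_vec q u v w) = 0"
proof -
  have "G q *v curv_vec q u v w = (\<Sum>k\<in>UNIV. \<Sum>l\<in>UNIV. (u $ k * v $ l) *\<^sub>R (G q *v (curv_mat k l q *v w)))"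
    unfolding curv_vec_def by (simp add: linear_sum[OF matrix_vector_mul_linear] matrix_vector_mult_scaleR)
  then show ?thesis by (simp add: inner_sum_right curv_skew[OF q])
qed

text \<open>Polarization of the diagonal case.\<close>

lemma curv_vec_skew:
  assumes q: "q \<in> S" shows "w \<bullet> (G q *v curv_vec q u v z) = - (z \<bullet> (G q *v curv_vec q u v w))"
  using curv_vec_skew_diag[OF q, of "w + z" u v] curv_vec_skew_diag[OF q, of w u v] curv_vec_skew_diag[OF q, of z u v]
  by (simp add: curv_vec_add matrix_vector_right_distrib inner_add_left inner_add_right)

text \<open>Expands the squared length of the rejection of \<open>v\<close> from \<open>w\<close>, scaled by \<open>g(w,w)\<close>. It yields the
Cauchy-Schwarz inequality and its strict form.\<close>

lemma gram_identity:
  assumes q: "q \<in> S"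
  defines "z \<equiv> \<lambda>v w. (w \<bullet> (G q *v w)) *\<^sub>R v - (w \<bullet> (G q *v v)) *\<^sub>R w"
  shows "z v w \<bullet> (G q *v z v w)
    = (w \<bullet> (G q *v w)) * ((w \<bullet> (G q *v w)) * (v \<bullet> (G q *v v)) - (w \<bullet> (G q *v v))\<^sup>2)"
  using inner_metric_sym[OF q, of v w]
  by (simp add: z_def matrix_vector_mult_diff_distrib matrix_vector_mult_scaleR inner_diff_left
      inner_diff_right algebra_simps power2_eq_square)

lemma metric_nonneg: "q \<in> S \<Longrightarrow> w \<bullet> (G q *v w) \<ge> 0"
  using metric_pos[of q w] by (cases "w = 0") auto

lemma metric_Cauchy_Schwarz:
  assumes q: "q \<in> S"
  shows "(w \<bullet> (G q *v v))\<^sup>2 \<le> (w \<bullet> (G q *v w)) * (v \<bullet> (G q *v v))"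
proof (cases "w = 0")
  case False
  have "0 \<le> (w \<bullet> (G q *v w)) * ((w \<bullet> (G q *v w)) * (v \<bullet> (G q *v v)) - (w \<bullet> (G q *v v))\<^sup>2)"
    using metric_nonneg[OF q] gram_identity[OF q, of w v] by metis
  then show ?thesis using metric_pos[OF q False] by (simp add: zero_le_mult_iff)
qed simp

lemma metric_gram_pos:
  assumes q: "q \<in> S" and indep: "\<And>a b. a *\<^sub>R w + b *\<^sub>R v = 0 \<Longrightarrow> a = 0 \<and> b = 0"
  shows "(w \<bullet> (G q *v w)) * (v \<bullet> (G q *v v)) - (w \<bullet> (G q *v v))\<^sup>2 > 0"
proof -
  have w: "w \<noteq> 0" using indep[of 1 0] by auto
  have "(w \<bullet> (G q *v w)) *\<^sub>R v - (w \<bullet> (G q *v v)) *\<^sub>R w \<noteq> 0"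
    using indep[of "- (w \<bullet> (G q *v v))" "w \<bullet> (G q *v w)"] metric_pos[OF q w] by auto
  from metric_pos[OF q this] show ?thesis
    unfolding gram_identity[OF q] using metric_pos[OF q w] by (simp add: zero_less_mult_iff)
qed

end

lemma (in chart_parallel_form) form_curv_vec:
  assumes q: "q \<in> S" shows "form_vec q \<bullet> curv_vec q u v w = 0"
  unfolding curv_vec_def by (simp add: inner_sum_right form_curv[OF q])

context chart_spray begin

definition rho :: "real^'n \<Rightarrow> real^'n \<Rightarrow> real" where
  "rho q w = \<phi> (form_sq q) (s_loc q w) * (\<phi> (form_sq q) (s_loc q w) - s_loc q w * d2 \<phi> (form_sq q) (s_loc q w))"

lemma alpha_loc_squared: "q \<in> S \<Longrightarrow> w \<noteq> 0 \<Longrightarrow> w \<bullet> (G q *v w) = (alpha_loc q w)\<^sup>2"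
  using metric_pos[of q w] by (simp add: alpha_loc_def)

lemma ds_loc_self: "q \<in> S \<Longrightarrow> w \<noteq> 0 \<Longrightarrow> ds_loc q w w = 0"
  using alpha_loc_pos[of q w] by (simp add: ds_loc_def alpha_loc_squared s_loc_def power2_eq_square)

lemma fund_form_self:
  assumes "q \<in> S" "w \<noteq> 0" shows "fund_form q w w w = (F_loc q w)\<^sup>2"
  using alpha_loc_pos[OF assms] ds_loc_self[OF assms] alpha_loc_squared[OF assms]
  by (simp add: fund_form_def Let_def F_loc_def s_loc_def field_simps power2_eq_square)

text \<open>Under the two hypotheses the differential of \<open>s\<close> and the first variation of \<open>\<alpha>\<close> in direction \<open>r\<close> vanish, and only the
leading term of the fundamental tensor survives.\<close>

lemma fund_form_orthogonal_to_form:
  assumes "form_vec q \<bullet> r = 0" "w \<bullet> (G q *v r) = 0"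
  shows "fund_form q w r v = rho q w * (r \<bullet> (G q *v v))"
  using assms by (simp add: fund_form_def Let_def rho_def ds_loc_def)

text \<open>\<open>R(v,w)w\<close> satisfies both orthogonality conditions, and the pair symmetry needed to pass from
\<open>g(R(v,w)w,v)\<close> to \<open>g(R(w,v)v,w)\<close> follows from the two skew symmetries.\<close>

lemma fund_form_curvature:
  assumes q: "q \<in> S"
  shows "fund_form q w (curv_vec q v w w) v = rho q w * (w \<bullet> (G q *v curv_vec q w v v))"
proof -
  have "curv_vec q v w w \<bullet> (G q *v v) = w \<bullet> (G q *v curv_vec q w v v)"
    using inner_metric_sym[OF q, of "curv_vec q v w w" v] curv_vec_skew[OF q, of v v w w] curv_vec_swap[of q v w v]
    by (simp add: linear_neg[OF matrix_vector_mul_linear])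
  then show ?thesis
    using fund_form_orthogonal_to_form[OF form_curv_vec[OF q] curv_vec_skew_diag[OF q]] by simp
qed

text \<open>Let \<open>z\<close> be the component of the dual vector \<open>X\<close> orthogonal to the plane of \<open>w\<close> and \<open>v\<close>. If \<open>z \<noteq> 0\<close>, then the plane of
\<open>v\<close> and \<open>z\<close> contains a nonzero vector that is annihilated by \<open>\<beta>\<close>; it is orthogonal to \<open>w\<close>, so the
fundamental tensor on it equals \<open>\<rho>\<close> times \<open>g\<close> and is not positive. Hence \<open>X\<close> lies in the plane of \<open>w\<close> and \<open>v\<close>. Its
component \<open>s\<close> along \<open>w\<close> is nonzero, as otherwise \<open>\<rho> = \<phi>\<^sup>2 > 0\<close>. Now \<open>0 = \<beta>(R(w,v)v) = g(X, R(w,v)v)\<close>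
equals \<open>s g(w, R(w,v)v)\<close>, the component along \<open>v\<close> contributing nothing.\<close>

lemma curvature_zero_if_rho_zero:
  assumes q: "q \<in> S" and on: "w \<bullet> (G q *v w) = 1" "v \<bullet> (G q *v v) = 1" "w \<bullet> (G q *v v) = 0"
    and rho: "rho q w = 0"
  shows "w \<bullet> (G q *v curv_vec q w v v) = 0"
proof -
  have w: "w \<noteq> 0" using on by auto
  have alpha_loc: "alpha_loc q w = 1" using on by (simp add: alpha_loc_def)
  define X where "X = matrix_inv (G q) *v form_vec q"
  have GX: "G q *v X = form_vec q"
    by (simp add: X_def matrix_vector_mul_assoc invertible_matrix_inv[OF metric_invertible[OF q]])
  have X: "z \<bullet> (G q *v X) = form_vec q \<bullet> z" for z by (simp add: GX inner_commute)
  define z where "z = X - (form_vec q \<bullet> w) *\<^sub>R w - (form_vec q \<bullet> v) *\<^sub>R v"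
  have vw: "v \<bullet> (G q *v w) = 0" using on inner_metric_sym[OF q] by simp
  have zw: "w \<bullet> (G q *v z) = 0" and zv: "v \<bullet> (G q *v z) = 0"
    by (simp_all add: z_def matrix_vector_mult_diff_distrib matrix_vector_mult_scaleR inner_diff_right
      X on vw)
  have zz: "z \<bullet> (G q *v z) = form_vec q \<bullet> z"
  proof -
    have "z \<bullet> (G q *v z) = z \<bullet> (G q *v X)"
      using zw zv inner_metric_sym[OF q, of z]
      by (subst (2) z_def) (simp add: matrix_vector_mult_diff_distrib matrix_vector_mult_scaleR inner_diff_right)
    then show ?thesis by (simp add: X)
  qed
  have "z = 0"
  proof (rule ccontr)
    assume "z \<noteq> 0"
    \<comment> \<open>the combination of \<open>v\<close> and \<open>z\<close> on which \<open>\<beta>\<close> vanishes\<close>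
    define r where "r = (form_vec q \<bullet> z) *\<^sub>R v - (form_vec q \<bullet> v) *\<^sub>R z"
    have "form_vec q \<bullet> r = 0" by (simp add: r_def inner_diff_right)
    moreover have "w \<bullet> (G q *v r) = 0"
      by (simp add: r_def matrix_vector_mult_diff_distrib matrix_vector_mult_scaleR inner_diff_right on zw)
    ultimately have "fund_form q w r r = 0" using fund_form_orthogonal_to_form[of q r w r] rho by simp
    moreover have "v \<bullet> (G q *v r) = form_vec q \<bullet> z"
      by (simp add: r_def matrix_vector_mult_diff_distrib matrix_vector_mult_scaleR inner_diff_right on zv)
    then have "r \<noteq> 0" using zz metric_pos[OF q \<open>z \<noteq> 0\<close>] by auto
    ultimately show False using fund_form_pos[OF q w] by fastforce
  qed
  then have X_eq: "X = (form_vec q \<bullet> w) *\<^sub>R w + (form_vec q \<bullet> v) *\<^sub>R v" by (simp add: z_def algebra_simps)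
  have "form_vec q \<bullet> w \<noteq> 0"
    using rho phi_pos[OF q w] by (auto simp: rho_def s_loc_def)
  moreover have "(form_vec q \<bullet> w) * (w \<bullet> (G q *v curv_vec q w v v)) + (form_vec q \<bullet> v) * (v \<bullet> (G q *v curv_vec q w v v)) = 0"
    using X[of "curv_vec q w v v"] form_curv_vec[OF q, of w v v] inner_metric_sym[OF q, of X "curv_vec q w v v"]
    by (simp add: X_eq inner_add_left)
  ultimately show ?thesis by (simp add: curv_vec_skew_diag[OF q])
qed

text \<open>For an orthonormal pair the denominator of the flag curvature is \<open>\<phi>\<^sup>3 (\<phi> - s \<phi>\<^sub>2 + \<beta>(v)\<^sup>2 \<phi>\<^sub>2\<^sub>2)\<close>: the terms in
\<open>\<phi>\<^sub>2\<^sup>2\<close> cancel.\<close>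

lemma orthonormal_flag:
  assumes q: "q \<in> S" and on: "w \<bullet> (G q *v w) = 1" "v \<bullet> (G q *v v) = 1" "w \<bullet> (G q *v v) = 0"
  shows "rho q w * (w \<bullet> (G q *v curv_vec q w v v)) / ((F_loc q w)\<^sup>2 * fund_form q w v v - (fund_form q w w v)\<^sup>2)
     = 1 / ((\<phi> (form_sq q) (s_loc q w))\<^sup>2 * (1 + (form_vec q \<bullet> v)\<^sup>2 * (d2 (d2 \<phi>) (form_sq q) (s_loc q w)
            / (\<phi> (form_sq q) (s_loc q w) - s_loc q w * d2 \<phi> (form_sq q) (s_loc q w))))) * (w \<bullet> (G q *v curv_vec q w v v))"
proof -
  have w: "w \<noteq> 0" using on by auto
  have alpha_loc: "alpha_loc q w = 1" using on by (simp add: alpha_loc_def)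
  define f f1 f2 e B K where defs: "f = \<phi> (form_sq q) (s_loc q w)" "f1 = d2 \<phi> (form_sq q) (s_loc q w)"
    "f2 = d2 (d2 \<phi>) (form_sq q) (s_loc q w)" "e = f - s_loc q w * f1" "B = form_vec q \<bullet> v"
    "K = w \<bullet> (G q *v curv_vec q w v v)"
  have f: "f > 0" using phi_pos[OF q w] by (simp add: defs)
  have "ds_loc q w v = B" by (simp add: ds_loc_def on alpha_loc defs)
  then have vv: "fund_form q w v v = f * e + (f1\<^sup>2 + f * f2) * B\<^sup>2"
    by (simp add: fund_form_def Let_def on alpha_loc defs power2_eq_square)
  have wv: "fund_form q w w v = f * f1 * B"
    by (simp add: fund_form_def Let_def on alpha_loc defs ds_loc_self[OF q w])
  have rho: "rho q w = f * e" by (simp add: rho_def defs)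
  have F_loc: "F_loc q w = f" by (simp add: F_loc_def alpha_loc defs)
  have den: "(F_loc q w)\<^sup>2 * fund_form q w v v - (fund_form q w w v)\<^sup>2 = f ^ 3 * (e + B\<^sup>2 * f2)"
    unfolding vv wv F_loc by (simp add: algebra_simps power2_eq_square power3_eq_cube)
  have "f * e * K / (f ^ 3 * (e + B\<^sup>2 * f2)) = 1 / (f\<^sup>2 * (1 + B\<^sup>2 * (f2 / e))) * K"
  proof (cases "e = 0")
    \<comment> \<open>the right-hand side is then \<open>K / f\<^sup>2\<close> as \<open>f2 / 0 = 0\<close>, and the left-hand side is \<open>0\<close>\<close>
    case True
    then show ?thesis
      using curvature_zero_if_rho_zero[OF q on] rho by (simp add: defs)
  next
    case False
    then have "1 + B\<^sup>2 * (f2 / e) = (e + B\<^sup>2 * f2) / e" by (simp add: field_simps)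
    then show ?thesis using f False by (simp add: power2_eq_square power3_eq_cube)
  qed
  then show ?thesis unfolding den rho unfolding defs .
qed

end

section \<open>Tangent vectors in coordinates\<close>

locale manifold_chart =
  fixes M :: "'m topology" and A :: "('m, 'n::finite) chart set" and c :: "('m, 'n) chart"
  assumes manifold: "smooth_manifold M A" and chart: "c \<in> A"
begin

lemma chart_open: "c' \<in> A \<Longrightarrow> openin M (chart_dom c')"
  using manifold by (auto simp: smooth_manifold_def)

lemma chart_subset: "c' \<in> A \<Longrightarrow> chart_dom c' \<subseteq> topspace M"
  using chart_open openin_subset by blast

lemma open_chart_image: "c' \<in> A \<Longrightarrow> open (chart_image c')"
  using manifold by (auto simp: smooth_manifold_def)

lemma chart_homeo:
  "c' \<in> A \<Longrightarrow> homeomorphic_map (subtopology M (chart_dom c')) (top_of_set (chart_image c')) (coord c')"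
  using manifold by (auto simp: smooth_manifold_def)

lemma chart_inj: "c' \<in> A \<Longrightarrow> inj_on (coord c') (chart_dom c')"
  using homeomorphic_imp_injective_map[OF chart_homeo, of c'] chart_subset[of c']
  by (simp add: Int_absorb1)

lemma chart_inv_coord: "c' \<in> A \<Longrightarrow> x \<in> chart_dom c' \<Longrightarrow> chart_inv c' (coord c' x) = x"
  by (simp add: chart_inv_def chart_inj)

lemma chart_inv_in: "p \<in> chart_image c' \<Longrightarrow> chart_inv c' p \<in> chart_dom c'"
  by (simp add: chart_inv_def chart_image_def inv_into_into)

lemma coord_chart_inv: "p \<in> chart_image c' \<Longrightarrow> coord c' (chart_inv c' p) = p"
  by (simp add: chart_inv_def chart_image_def f_inv_into_f)

lemma overlap_open:
  assumes "c' \<in> A" "c'' \<in> A"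
  shows "open (coord c' ` (chart_dom c' \<inter> chart_dom c''))"
proof -
  have "openin (subtopology M (chart_dom c')) (chart_dom c' \<inter> chart_dom c'')"
    using chart_open[OF assms(2)] unfolding openin_subtopology by blast
  then have "openin (top_of_set (chart_image c')) (coord c' ` (chart_dom c' \<inter> chart_dom c''))"
    using homeomorphic_map_openness[OF chart_homeo[OF assms(1)], of "chart_dom c' \<inter> chart_dom c''"]
      chart_subset[OF assms(1)] by (simp add: le_infI1)
  then show ?thesis using open_chart_image[OF assms(1)] openin_open_trans by blast
qed

lemma transition_has_derivative:
  assumes "c' \<in> A" "c'' \<in> A" "x \<in> chart_dom c'" "x \<in> chart_dom c''"
  shows "(transition c' c'' has_derivative frechet_derivative (transition c' c'') (at (coord c' x))) (at (coord c' x))"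
proof -
  have "smooth_on (transition c' c'') (coord c' ` (chart_dom c' \<inter> chart_dom c''))"
    using manifold assms by (auto simp: smooth_manifold_def)
  from smooth_on_differentiable[OF this] assms show ?thesis
    by (auto simp: frechet_derivative_works[symmetric])
qed

lemma transition_coord: "c' \<in> A \<Longrightarrow> x \<in> chart_dom c' \<Longrightarrow> transition c' c'' (coord c' x) = coord c'' x"
  by (simp add: transition_def chart_inv_coord)

text \<open>The chain rule for the Jacobians of the transition maps: the components of one vector in one chart determine a
consistent family of components in all charts.\<close>

lemma transition_cocycle:
  assumes c: "c1 \<in> A" "c2 \<in> A" "c3 \<in> A" and x: "x \<in> chart_dom c1" "x \<in> chart_dom c2" "x \<in> chart_dom c3"
  shows "frechet_derivative (transition c2 c3) (at (coord c2 x))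
      (frechet_derivative (transition c1 c2) (at (coord c1 x)) w)
    = frechet_derivative (transition c1 c3) (at (coord c1 x)) w"
proof -
  let ?V = "coord c1 ` (chart_dom c1 \<inter> chart_dom c2)"
  have "((\<lambda>q. transition c2 c3 (transition c1 c2 q)) has_derivative
      (\<lambda>w. frechet_derivative (transition c2 c3) (at (coord c2 x))
      (frechet_derivative (transition c1 c2) (at (coord c1 x)) w))) (at (coord c1 x))"
    by (rule has_derivative_compose[OF transition_has_derivative])
       (use c x transition_has_derivative[of c2 c3 x] in \<open>auto simp: transition_coord\<close>)
  then have "(transition c1 c3 has_derivative
      (\<lambda>w. frechet_derivative (transition c2 c3) (at (coord c2 x))
      (frechet_derivative (transition c1 c2) (at (coord c1 x)) w))) (at (coord c1 x))"
    by (rule has_derivative_transform_within_open[where s="?V"])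
       (use c x overlap_open in \<open>auto simp: transition_coord\<close>)
  from has_derivative_unique[OF this transition_has_derivative[OF c(1,3) x(1,3)]]
  show ?thesis by (rule fun_cong)
qed

lemma transition_self:
  assumes "c' \<in> A" "x \<in> chart_dom c'"
  shows "frechet_derivative (transition c' c') (at (coord c' x)) w = w"
proof -
  have "(transition c' c' has_derivative (\<lambda>w. w)) (at (coord c' x))"
    by (rule has_derivative_transform_within_open[OF has_derivative_ident open_chart_image[OF assms(1)]])
       (use assms in \<open>auto simp: transition_coord chart_image_def\<close>)
  from frechet_derivative_at[OF this] show ?thesis by (rule fun_cong[OF sym])
qed

context
  fixes x assumes x: "x \<in> chart_dom c"
begin

lemma tvec_of_in: "tvec_of A x c w \<in> tangent_space A x"
  using transition_cocycle[OF chart _ _ x] by (auto simp: tangent_space_def tvec_of_def)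

lemma tvec_of_self: "tvec_of A x c w c = w"
  by (simp add: tvec_of_def chart x transition_self)

lemma tvec_of_components: "v \<in> tangent_space A x \<Longrightarrow> tvec_of A x c (v c) = v"
proof -
  assume v: "v \<in> tangent_space A x"
  show ?thesis
  proof
    fix c'
    show "tvec_of A x c (v c) c' = v c'"
    proof (cases "c' \<in> A \<and> x \<in> chart_dom c'")
      case True
      then have "v c' = frechet_derivative (transition c c') (at (coord c x)) (v c)"
        using v chart x unfolding tangent_space_def mem_Collect_eq by blast
      with True show ?thesis by (simp add: tvec_of_def)
    next
      case False
      then have "v c' = 0" using v unfolding tangent_space_def mem_Collect_eq by blast
      then show ?thesis unfolding tvec_of_def if_not_P[OF False] by simp
    qed
  qed
qed

lemma tvec_of_add: "tadd (tvec_of A x c v) (tvec_of A x c w) = tvec_of A x c (v + w)"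
  using linear_add[OF has_derivative_linear[OF transition_has_derivative[OF chart _ x]]]
  by (auto simp: tadd_def tvec_of_def)

lemma tvec_of_scale: "tscale a (tvec_of A x c w) = tvec_of A x c (a *\<^sub>R w)"
  using linear_scale[OF has_derivative_linear[OF transition_has_derivative[OF chart _ x]]]
  by (auto simp: tscale_def tvec_of_def)

lemma tvec_of_eq_tzero: "tvec_of A x c w = tzero \<longleftrightarrow> w = 0"
proof
  assume "tvec_of A x c w = tzero"
  then have "tvec_of A x c w c = 0" by (simp add: tzero_def)
  then show "w = 0" by (simp add: tvec_of_self)
next
  assume "w = 0"
  then show "tvec_of A x c w = tzero" using tvec_of_scale[of 0 0] by (simp add: tzero_def tscale_def)
qed

lemma tangent_linear_coords:
  assumes "tangent_linear (tangent_space A x) f"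
  shows "linear (\<lambda>w. f (tvec_of A x c w))"
  using assms tvec_of_in by (intro linearI) (auto simp: tangent_linear_def tvec_of_add[symmetric] tvec_of_scale[symmetric])

end

end

section \<open>The structures on the manifold in coordinates\<close>

text \<open>Here \<open>pt p\<close> is the point with coordinates \<open>p\<close> in the chart \<open>c\<close>, and \<open>T p\<close> is the linear isomorphism from
\<open>real^'n\<close> onto the tangent space at this point. Each object of the theorem is pulled back along \<open>T p\<close>.\<close>

locale riemannian_chart = manifold_chart M A c
  for M :: "'m topology" and A :: "('m, 'n::finite) chart set" and c +
  fixes g :: "'m \<Rightarrow> ('m, 'n) tvec \<Rightarrow> ('m, 'n) tvec \<Rightarrow> real"
  assumes riemannian: "riemannian_metric M A g"
begin

abbreviation S :: "(real^'n) set" where "S \<equiv> chart_image c"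

abbreviation pt :: "real^'n \<Rightarrow> 'm" where "pt p \<equiv> chart_inv c p"

abbreviation T :: "real^'n \<Rightarrow> real^'n \<Rightarrow> ('m, 'n) tvec" where "T p w \<equiv> tvec_of A (pt p) c w"

lemma pt_in: "p \<in> S \<Longrightarrow> pt p \<in> chart_dom c"
  by (rule chart_inv_in)

lemma pt_in_M: "p \<in> S \<Longrightarrow> pt p \<in> topspace M"
  using chart_inv_in chart_subset[OF chart] by blast

lemma T_in: "p \<in> S \<Longrightarrow> T p w \<in> tangent_space A (pt p)"
  by (rule tvec_of_in[OF pt_in])

lemma metric_commute: "p \<in> S \<Longrightarrow> g (pt p) (T p v) (T p w) = g (pt p) (T p w) (T p v)"
  using riemannian pt_in_M[of p] T_in[of p] by (simp add: riemannian_metric_def)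

lemma metric_linear: "p \<in> S \<Longrightarrow> linear (\<lambda>w. g (pt p) (T p v) (T p w))"
  using riemannian pt_in_M[of p] T_in[of p]
  by (intro tangent_linear_coords[OF pt_in]) (simp_all add: riemannian_metric_def)

lemma metric_coords:
  assumes p: "p \<in> S"
  shows "g (pt p) (T p v) (T p w) = v \<bullet> (metric_mat A g c p *v w)"
proof -
  have "g (pt p) (T p v) (T p w) = (\<Sum>i\<in>UNIV. v $ i * g (pt p) (T p (axis i 1)) (T p w))"
    using linear_eq_sum_axis[OF metric_linear[OF p, of w], of v] by (simp add: metric_commute[OF p, of _ w])
  also have "\<dots> = (\<Sum>i\<in>UNIV. v $ i * (\<Sum>j\<in>UNIV. w $ j * g (pt p) (T p (axis i 1)) (T p (axis j 1))))"
    by (subst linear_eq_sum_axis[OF metric_linear[OF p], of _ w]) rule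
  also have "\<dots> = v \<bullet> (metric_mat A g c p *v w)"
    by (simp add: inner_vec_def matrix_vector_mult_def metric_mat_def coord_vec_def mult.commute)
  finally show ?thesis .
qed

sublocale chart_metric A g c "chart_image c"
proof
  show "open S" by (rule open_chart_image[OF chart])
  show "smooth_on (metric_mat A g c) S" using riemannian chart by (simp add: riemannian_metric_def)
next
  fix q i j assume "q \<in> S"
  then show "metric_mat A g c q $ i $ j = metric_mat A g c q $ j $ i"
    using metric_commute[of q] by (simp add: metric_mat_def coord_vec_def)
next
  fix q w assume q: "q \<in> S" and "(w :: real^'n) \<noteq> 0"
  then have "T q w \<noteq> tzero" using tvec_of_eq_tzero[OF pt_in] by simp
  then have "g (pt q) (T q w) (T q w) > 0"
    using riemannian pt_in_M[OF q] T_in[OF q, of w] by (simp add: riemannian_metric_def)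
  then show "w \<bullet> (metric_mat A g c q *v w) > 0" by (simp add: metric_coords[OF q])
qed

lemma riemann_curv_coords:
  assumes p: "p \<in> S"
  shows "riemann_curv A g c (pt p) (T p u) (T p v) (T p w) = T p (curv_vec p u v w)"
proof -
  have "(\<Sum>j\<in>UNIV. \<Sum>k\<in>UNIV. \<Sum>l\<in>UNIV. curv_comp A g c i j k l p * w $ j * u $ k * v $ l)
     = curv_vec p u v w $ i" for i
  proof -
    have "curv_vec p u v w $ i = (\<Sum>k\<in>UNIV. \<Sum>l\<in>UNIV. \<Sum>j\<in>UNIV. curv_comp A g c i j k l p * w $ j * u $ k * v $ l)"
      by (simp add: curv_vec_def curv_mat_def matrix_vector_mult_def sum_distrib_left mult_ac)
    also have "\<dots> = (\<Sum>k\<in>UNIV. \<Sum>j\<in>UNIV. \<Sum>l\<in>UNIV. curv_comp A g c i j k l p * w $ j * u $ k * v $ l)"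
      by (intro sum.cong refl sum.swap)
    also have "\<dots> = (\<Sum>j\<in>UNIV. \<Sum>k\<in>UNIV. \<Sum>l\<in>UNIV. curv_comp A g c i j k l p * w $ j * u $ k * v $ l)"
      by (rule sum.swap)
    finally show ?thesis by simp
  qed
  then show ?thesis
    unfolding riemann_curv_def by (simp add: tvec_of_self[OF pt_in[OF p]] coord_chart_inv[OF p])
qed

end

locale parallel_form_chart = riemannian_chart M A c g
  for M :: "'m topology" and A :: "('m, 'n::finite) chart set" and c g +
  fixes \<beta> :: "'m \<Rightarrow> ('m, 'n) tvec \<Rightarrow> real"
  assumes form: "one_form M A \<beta>" and form_parallel: "parallel_form A g \<beta>"
begin

sublocale chart_parallel_form A g c "chart_image c" \<beta>
proof
  show "smooth_on (form_comp A \<beta> c i) S" for i using form chart by (simp add: one_form_def)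
  show "pd j (form_comp A \<beta> c i) q = (\<Sum>k\<in>UNIV. christoffel A g c k i j q * form_comp A \<beta> c k q)"
    if "q \<in> S" for q i j
  proof -
    have "pd j (form_comp A \<beta> c i) q - (\<Sum>k\<in>UNIV. christoffel A g c k i j q * form_comp A \<beta> c k q) = 0"
      using form_parallel chart that unfolding parallel_form_def by blast
    then show ?thesis by simp
  qed
qed

lemma form_coords:
  assumes p: "p \<in> S"
  shows "\<beta> (pt p) (T p w) = form_vec p \<bullet> w"
proof -
  have "linear (\<lambda>w. \<beta> (pt p) (T p w))"
    using form pt_in_M[OF p] by (intro tangent_linear_coords[OF pt_in[OF p]]) (simp add: one_form_def)
  from linear_eq_sum_axis[OF this, of w] show ?thesis
    by (simp add: form_vec_def inner_vec_def form_comp_def coord_vec_def mult.commute)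
qed

definition sharp_vec :: "real^'n \<Rightarrow> real^'n" where
  "sharp_vec p = matrix_inv (G p) *v form_vec p"

lemma metric_sharp_vec: "p \<in> S \<Longrightarrow> G p *v sharp_vec p = form_vec p"
  by (simp add: sharp_vec_def matrix_vector_mul_assoc invertible_matrix_inv[OF metric_invertible])

lemma sharp_coords:
  assumes p: "p \<in> S"
  shows "sharp A g \<beta> (pt p) = T p (sharp_vec p)"
  unfolding sharp_def
proof (rule the_equality)
  note rep = tvec_of_components[OF pt_in[OF p], symmetric]
  show "T p (sharp_vec p) \<in> tangent_space A (pt p) \<and>
      (\<forall>v\<in>tangent_space A (pt p). \<beta> (pt p) v = g (pt p) (T p (sharp_vec p)) v)"
  proof (intro conjI ballI T_in p)
    fix v assume "v \<in> tangent_space A (pt p)"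
    then obtain w where v: "v = T p w" using rep by blast
    show "\<beta> (pt p) v = g (pt p) (T p (sharp_vec p)) v"
      unfolding v form_coords[OF p] metric_coords[OF p]
      using inner_metric_sym[OF p, of "sharp_vec p" w] metric_sharp_vec[OF p] by (simp add: inner_commute)
  qed
  fix X assume X: "X \<in> tangent_space A (pt p) \<and> (\<forall>v\<in>tangent_space A (pt p). \<beta> (pt p) v = g (pt p) X v)"
  then obtain z where z: "X = T p z" using rep by blast
  have "w \<bullet> (G p *v z) = w \<bullet> form_vec p" for w
  proof -
    have "\<beta> (pt p) (T p w) = g (pt p) (T p z) (T p w)"
      using X T_in[OF p, of w] unfolding z by blast
    then show ?thesis
      using inner_metric_sym[OF p, of w z] by (simp add: form_coords[OF p] metric_coords[OF p] inner_commute)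
  qed
  then have "G p *v z = form_vec p" using vector_eq_ldot by blast
  then have "z = sharp_vec p"
    unfolding sharp_vec_def by (metis matrix_vector_mul_assoc invertible_matrix_inv(2)[OF metric_invertible[OF p]] matrix_vector_mul_lid)
  then show "X = T p (sharp_vec p)" by (simp add: z)
qed

lemma form_sq_eq: "p \<in> S \<Longrightarrow> form_sq p = sharp_vec p \<bullet> (G p *v sharp_vec p)"
  by (simp add: metric_sharp_vec form_sq_def sharp_vec_def[symmetric] inner_commute)

lemma form_norm_coords: "p \<in> S \<Longrightarrow> form_norm A g \<beta> (pt p) = sqrt (form_sq p)"
  by (simp add: form_norm_def alpha_norm_def sharp_coords metric_coords form_sq_eq)

lemma form_norm_squared: "p \<in> S \<Longrightarrow> (form_norm A g \<beta> (pt p))\<^sup>2 = form_sq p"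
  using metric_nonneg by (simp add: form_norm_coords) (simp add: form_sq_eq)

text \<open>\<open>\<bar>s\<bar> \<le> b\<close> by the Cauchy-Schwarz inequality, applied to the dual vector of \<open>\<beta>\<close>. So the arguments of \<open>\<phi>\<close> that occur lie
in its domain.\<close>

lemma form_bound:
  assumes p: "p \<in> S" and w: "w \<noteq> 0"
  shows "\<bar>form_vec p \<bullet> w / sqrt (w \<bullet> (G p *v w))\<bar> \<le> sqrt (form_sq p)"
proof -
  have "(form_vec p \<bullet> w)\<^sup>2 \<le> (w \<bullet> (G p *v w)) * form_sq p"
    using metric_Cauchy_Schwarz[OF p, of w "sharp_vec p"] by (simp add: form_sq_eq[OF p] metric_sharp_vec[OF p] inner_commute)
  then have "\<bar>form_vec p \<bullet> w\<bar> \<le> sqrt ((w \<bullet> (G p *v w)) * form_sq p)" by (rule real_le_rsqrt[of "\<bar>_\<bar>", simplified])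
  then show ?thesis
    using metric_pos[OF p w] by (simp add: real_sqrt_mult divide_le_eq mult.commute)
qed

end

locale alpha_beta_chart = parallel_form_chart M A c g \<beta>
  for M :: "'m topology" and A :: "('m, 'n::finite) chart set" and c g \<beta> +
  fixes b0 :: ereal and \<phi> :: "real \<Rightarrow> real \<Rightarrow> real" and F :: "'m \<Rightarrow> ('m, 'n) tvec \<Rightarrow> real"
    and U :: "(real \<times> real) set"
  assumes alpha_beta: "general_alpha_beta_metric M A g \<beta> b0 \<phi> F"
    and U: "open U" "phi_domain b0 \<subseteq> U" "smooth_on (\<lambda>(t, s). \<phi> t s) U"
begin

lemma in_phi_domain:
  assumes p: "p \<in> S" and w: "w \<noteq> 0"
  shows "(form_sq p, form_vec p \<bullet> w / sqrt (w \<bullet> (G p *v w))) \<in> phi_domain b0"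
proof -
  have "ereal (form_norm A g \<beta> (pt p)) < b0"
    using alpha_beta pt_in_M[OF p] by (simp add: general_alpha_beta_metric_def)
  then show ?thesis
    unfolding phi_domain_def using form_bound[OF p w] form_norm_squared[OF p] form_norm_coords[OF p]
    by (intro CollectI exI[of _ "form_norm A g \<beta> (pt p)"] exI[of _ "form_vec p \<bullet> w / sqrt (w \<bullet> (G p *v w))"]) auto
qed

sublocale chart_alpha_beta A g c "chart_image c" \<beta> \<phi> U
  using U in_phi_domain by unfold_locales auto

lemma alpha_coords: "p \<in> S \<Longrightarrow> alpha_norm g (pt p) (T p w) = alpha_loc p w"
  by (simp add: alpha_norm_def alpha_loc_def metric_coords)

lemma F_coords: "p \<in> S \<Longrightarrow> F (pt p) (T p w) = F_loc p w"
  using alpha_beta pt_in_M[of p] T_in[of p w] unfolding general_alpha_beta_metric_def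
  by (simp add: alpha_coords form_norm_squared form_coords F_loc_def s_loc_def)

lemma fundamental_tensor_coords:
  assumes p: "p \<in> S" and w: "w \<noteq> 0"
  shows "fundamental_tensor F (pt p) (T p w) (T p u) (T p v) = fund_form p w u v"
  unfolding fundamental_tensor_def tvec_of_add[OF pt_in[OF p]] tvec_of_scale[OF pt_in[OF p]] F_coords[OF p]
    second_deriv_F_squared[OF p w] by simp

sublocale chart_spray A g c "chart_image c" \<beta> \<phi> U F
proof
  fix q w assume q: "q \<in> S" and w: "(w :: real^'n) \<noteq> 0"
  show "local_rep A F c q w = F_loc q w"
    by (simp add: local_rep_def F_coords[OF q])
  show "fundamental_mat A F c q w $ l $ m = fund_form q w (axis l 1) (axis m 1)" for l m
    by (simp add: fundamental_mat_def coord_vec_def fundamental_tensor_coords[OF q w])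
  show "\<phi> (form_sq q) (s_loc q w) > 0"
    using alpha_beta in_phi_domain[OF q w] unfolding general_alpha_beta_metric_def s_loc_def alpha_loc_def by fastforce
  fix v assume v: "(v :: real^'n) \<noteq> 0"
  have "finsler_metric M A F" using alpha_beta by (simp add: general_alpha_beta_metric_def)
  then have "fundamental_tensor F (pt q) (T q w) (T q v) (T q v) > 0"
    using pt_in_M[OF q] T_in[OF q] w v tvec_of_eq_tzero[OF pt_in[OF q]]
    unfolding finsler_metric_def by blast
  then show "fund_form q w v v > 0" by (simp add: fundamental_tensor_coords[OF q w])
qed

lemma finsler_curv_coords:
  assumes p: "p \<in> S" and w: "w \<noteq> 0"
  shows "finsler_curv A F c (pt p) (T p w) (T p v) = T p (curv_vec p v w w)"
proof -
  have "(\<Sum>k\<in>UNIV. finsler_curv_comp A F c i k p w * v $ k) = curv_vec p v w w $ i" for i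
    by (simp add: finsler_curv_comp_eq[OF p w] curv_vec_def sum_distrib_left sum_distrib_right mult_ac)
  then show ?thesis
    unfolding finsler_curv_def by (simp add: tvec_of_self[OF pt_in[OF p]] coord_chart_inv[OF p])
qed

lemma flag_curvature_coords:
  assumes p: "p \<in> S" and w: "w \<noteq> 0"
  shows "flag_curvature A F c (pt p) (T p w) (T p v)
    = rho p w * (w \<bullet> (G p *v curv_vec p w v v)) / ((F_loc p w)\<^sup>2 * fund_form p w v v - (fund_form p w w v)\<^sup>2)"
  unfolding flag_curvature_def finsler_curv_coords[OF p w] fundamental_tensor_coords[OF p w]
    fund_form_curvature[OF p] fund_form_self[OF p w] ..

lemma sectional_curvature_coords:
  assumes p: "p \<in> S"
  shows "sectional_curvature A g c (pt p) (T p w) (T p v)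
    = (w \<bullet> (G p *v curv_vec p w v v)) / ((w \<bullet> (G p *v w)) * (v \<bullet> (G p *v v)) - (w \<bullet> (G p *v v))\<^sup>2)"
  unfolding sectional_curvature_def riemann_curv_coords[OF p] metric_coords[OF p]
  using inner_metric_sym[OF p, of "curv_vec p w v v" w] by simp

end

theorem proposition2p2:
  fixes M :: "'m topology"
    and A :: "('m, 'n::finite) chart set"
    and g :: "'m \<Rightarrow> ('m, 'n) tvec \<Rightarrow> ('m, 'n) tvec \<Rightarrow> real"
    and \<beta> :: "'m \<Rightarrow> ('m, 'n) tvec \<Rightarrow> real"
    and \<phi> :: "real \<Rightarrow> real \<Rightarrow> real"
    and b0 :: ereal
    and F :: "'m \<Rightarrow> ('m, 'n) tvec \<Rightarrow> real"
    and x :: 'm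
    and c :: "('m, 'n) chart"
    and y u :: "('m, 'n) tvec"
    and b s \<rho> D :: real
    and X :: "('m, 'n) tvec"
  assumes "smooth_manifold M A"
    and "riemannian_metric M A g"
    and "one_form M A \<beta>"
    and "general_alpha_beta_metric M A g \<beta> b0 \<phi> F"
    and "parallel_form A g \<beta>"
    and "c \<in> A" and "x \<in> chart_dom c"
    and "y \<in> tangent_space A x" and "u \<in> tangent_space A x" and "lin_indep2 y u"
    and "b = form_norm A g \<beta> x"
    and "s = \<beta> x y / alpha_norm g x y"
    and "\<rho> = \<phi> (b\<^sup>2) s * (\<phi> (b\<^sup>2) s - s * d2 \<phi> (b\<^sup>2) s)"
    and "D = d2 (d2 \<phi>) (b\<^sup>2) s / (\<phi> (b\<^sup>2) s - s * d2 \<phi> (b\<^sup>2) s)"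
    and "X = sharp A g \<beta> x"
  shows "flag_curvature A F c x y u =
           ((alpha_norm g x y)\<^sup>2 * (alpha_norm g x u)\<^sup>2 - (g x y u)\<^sup>2) /
           ((F x y)\<^sup>2 * fundamental_tensor F x y u u - (fundamental_tensor F x y y u)\<^sup>2)
           * \<rho> * sectional_curvature A g c x y u
       \<and> (g x y y = 1 \<and> g x u u = 1 \<and> g x y u = 0 \<longrightarrow>
           flag_curvature A F c x y u =
             1 / ((\<phi> (b\<^sup>2) s)\<^sup>2 * (1 + (g x X u)\<^sup>2 * D)) * sectional_curvature A g c x y u)"
proof -
  obtain U where U: "open U" "phi_domain b0 \<subseteq> U" "smooth_on (\<lambda>(t, s). \<phi> t s) U"
    using assms(4) by (auto simp: general_alpha_beta_metric_def)
  interpret alpha_beta_chart M A c g \<beta> b0 \<phi> F U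
    using assms(1-6) U by unfold_locales
  define p where "p = coord c x"
  have p: "p \<in> S" using assms(7) by (simp add: p_def chart_image_def)
  have x: "x = pt p" using assms(6,7) by (simp add: p_def chart_inv_coord)
  define w v where "w = y c" and "v = u c"
  have y: "y = T p w" and u: "u = T p v"
    using assms(7-9) by (simp_all add: w_def v_def x[symmetric] tvec_of_components)
  have indep: "a *\<^sub>R w + e *\<^sub>R v = 0 \<Longrightarrow> a = 0 \<and> e = 0" for a e
    using assms(10) unfolding y u lin_indep2_def
    by (simp add: tvec_of_add[OF pt_in[OF p]] tvec_of_scale[OF pt_in[OF p]] tvec_of_eq_tzero[OF pt_in[OF p]])
  have w: "w \<noteq> 0" using indep[of 1 0] by auto
  have b: "b\<^sup>2 = form_sq p" using assms(11) by (simp add: x form_norm_squared[OF p])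
  have s: "s = s_loc p w" using assms(12) by (simp add: x y form_coords[OF p] alpha_coords[OF p] s_loc_def)
  have \<rho>: "\<rho> = rho p w" using assms(13) by (simp add: b s rho_def)
  have gX: "g x X u = form_vec p \<bullet> v"
    using assms(15) inner_metric_sym[OF p, of "sharp_vec p" v] metric_sharp_vec[OF p]
    by (simp add: x u sharp_coords[OF p] metric_coords[OF p] inner_commute)
  have al2: "(alpha_norm g x (T p z))\<^sup>2 = z \<bullet> (G p *v z)" for z
    using metric_nonneg[OF p, of z] by (simp add: x alpha_coords[OF p] alpha_loc_def)
  have gram: "(w \<bullet> (G p *v w)) * (v \<bullet> (G p *v v)) - (w \<bullet> (G p *v v))\<^sup>2 > 0"
    by (rule metric_gram_pos[OF p indep])
  let ?K = "w \<bullet> (G p *v curv_vec p w v v)"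
  let ?den = "(F_loc p w)\<^sup>2 * fund_form p w v v - (fund_form p w w v)\<^sup>2"
  have flag: "flag_curvature A F c x y u = rho p w * ?K / ?den"
    unfolding x y u by (rule flag_curvature_coords[OF p w])
  have sec: "sectional_curvature A g c x y u
      = ?K / ((w \<bullet> (G p *v w)) * (v \<bullet> (G p *v v)) - (w \<bullet> (G p *v v))\<^sup>2)"
    unfolding x y u by (rule sectional_curvature_coords[OF p])
  have den: "(F x y)\<^sup>2 * fundamental_tensor F x y u u - (fundamental_tensor F x y y u)\<^sup>2 = ?den"
    by (simp add: x y u F_coords[OF p] fundamental_tensor_coords[OF p w])
  have num: "(alpha_norm g x y)\<^sup>2 * (alpha_norm g x u)\<^sup>2 - (g x y u)\<^sup>2
      = (w \<bullet> (G p *v w)) * (v \<bullet> (G p *v v)) - (w \<bullet> (G p *v v))\<^sup>2"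
    using al2[of w] al2[of v] by (simp add: y[symmetric] u[symmetric]) (simp add: x y u metric_coords[OF p])
  have "flag_curvature A F c x y u =
           ((alpha_norm g x y)\<^sup>2 * (alpha_norm g x u)\<^sup>2 - (g x y u)\<^sup>2) /
           ((F x y)\<^sup>2 * fundamental_tensor F x y u u - (fundamental_tensor F x y y u)\<^sup>2)
           * \<rho> * sectional_curvature A g c x y u"
    unfolding flag sec den num \<rho> using gram by simp
  moreover have "flag_curvature A F c x y u =
             1 / ((\<phi> (b\<^sup>2) s)\<^sup>2 * (1 + (g x X u)\<^sup>2 * D)) * sectional_curvature A g c x y u"
    if "g x y y = 1 \<and> g x u u = 1 \<and> g x y u = 0"
  proof -
    have on: "w \<bullet> (G p *v w) = 1" "v \<bullet> (G p *v v) = 1" "w \<bullet> (G p *v v) = 0"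
      using that by (simp_all add: x y u metric_coords[OF p])
    then have "sectional_curvature A g c x y u = ?K" by (simp add: sec)
    then show ?thesis unfolding flag gX assms(14) b s orthonormal_flag[OF p on] by simp
  qed
  ultimately show ?thesis by blast
qed

end
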